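(* Let $\mathcal H$ be an infinite-dimensional separable Hilbert space, and let $\tau$ and $\sigma$ be operator means on $B(\mathcal H)^+$ with $\sigma\neq\mathfrak l$. For every $A,B\in B(\mathcal H)^{++}$ there exists a unique $X_0\in B(\mathcal H)^{++}$ satisfying $$X_0=(X_0\sigma A)\tau(X_0\sigma B).$$
   Context: $B(\mathcal H)$ is the space of bounded linear operators on $\mathcal H$, $B(\mathcal H)^+$ the cone of positive (semidefinite) operators, $B(\mathcal H)^{++}$ the cone of positive invertible operators. An operator mean (Kubo–Ando) is a map $\sigma:B(\mathcal H)^+\times B(\mathcal H)^+\to B(\mathcal H)^+$ satisfying, for $A,A',B,B',C\in B(\mathcal H)^+$: (I) $A\le A'$, $B\le B'$ imply $A\sigma B\le A'\sigma B'$; (II) $C(A\sigma B)C\le(CAC)\sigma(CBC)$; (III) if $A_k\searrow A$ and $B_k\searrow B$ then $A_k\sigma B_k\searrow A\sigma B$, where $A_k\searrow A$ means $A_1\ge A_2\ge\cdots$ and $A_k\to A$ in the strong operator topology; (IV) $I\sigma I=I$. By Kubo–Ando, each operator mean $\sigma$ corresponds to a unique non-negative operator monotone function $f_\sigma$ on $[0,\infty)$ with $f_\sigma(1)=1$ (its representing function) such that $A\sigma B=A^{1/2}f_\sigma(A^{-1/2}BA^{-1/2})A^{1/2}$ for $A,B\in B(\mathcal H)^{++}$ and $A\sigma B=\lim_{\varepsilon\searrow0}(A+\varepsilon I)\sigma(B+\varepsilon I)$ for $A,B\in B(\mathcal H)^+$; conversely every such function arises. $\mathfrak l$ is the left trivial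 mean $A\mathfrak lB=A$ (representing function $\equiv1$). *)

theory Defs
  imports "HOL-Analysis.Analysis"
begin

text \<open>
  A complex Hilbert space is a Banach space whose real structure is the restriction of a complex
  one and whose norm comes from a complex inner product, taken to be linear in the second argument.
\<close>

class complex_hilbert_space = banach +
  fixes scaleC :: "complex \<Rightarrow> 'a \<Rightarrow> 'a"  (infixr \<open>*\<^sub>C\<close> 75)
    and cinner :: "'a \<Rightarrow> 'a \<Rightarrow> complex"
  assumes scaleC_add_right: "c *\<^sub>C (x + y) = c *\<^sub>C x + c *\<^sub>C y"
    and scaleC_add_left: "(c + d) *\<^sub>C x = c *\<^sub>C x + d *\<^sub>C x"
    and scaleC_scaleC: "c *\<^sub>C d *\<^sub>C x = (c * d) *\<^sub>C x"
    and scaleC_one: "1 *\<^sub>C x = x"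
    and scaleR_eq_scaleC: "r *\<^sub>R x = complex_of_real r *\<^sub>C x"
    and cinner_commute: "cinner x y = cnj (cinner y x)"
    and cinner_add_right: "cinner x (y + z) = cinner x y + cinner x z"
    and cinner_scaleC_right: "cinner x (c *\<^sub>C y) = c * cinner x y"
    and cinner_self_nonneg: "0 \<le> Re (cinner x x)"
    and cinner_self_eq_0: "cinner x x = 0 \<longleftrightarrow> x = 0"
    and norm_eq_sqrt_cinner: "norm x = sqrt (Re (cinner x x))"

global_interpretation complex_vector:
  vector_space "scaleC :: complex \<Rightarrow> 'a \<Rightarrow> 'a :: complex_hilbert_space"
  by unfold_locales (simp_all add: scaleC_add_right scaleC_add_left scaleC_scaleC scaleC_one)

definition infinite_dimensional :: "'a::complex_hilbert_space itself \<Rightarrow> bool" where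
  "infinite_dimensional _ \<longleftrightarrow>
     \<not> (\<exists>S :: 'a set. finite S \<and> complex_vector.span S = UNIV)"

text \<open>
  The library type of bounded linear maps only requires real linearity, so \<open>B(H)\<close> is the
  set of those bounded maps that are moreover complex homogeneous.
\<close>

type_synonym 'a operator = "'a \<Rightarrow>\<^sub>L 'a"

definition bounded_ops :: "'a::complex_hilbert_space operator set" where
  "bounded_ops = {T. \<forall>c x. blinfun_apply T (c *\<^sub>C x) = c *\<^sub>C blinfun_apply T x}"

definition pos_ops :: "'a::complex_hilbert_space operator set" where
  "pos_ops = {T \<in> bounded_ops. \<forall>x. cinner x (blinfun_apply T x) \<in> \<real> \<and>
                                   0 \<le> Re (cinner x (blinfun_apply T x))}"

definition invertible_op :: "'a::complex_hilbert_space operator \<Rightarrow> bool" where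
  "invertible_op T \<longleftrightarrow>
     (\<exists>S \<in> bounded_ops. T o\<^sub>L S = id_blinfun \<and> S o\<^sub>L T = id_blinfun)"

definition pos_inv_ops :: "'a::complex_hilbert_space operator set" where
  "pos_inv_ops = {T \<in> pos_ops. invertible_op T}"

definition op_le :: "'a::complex_hilbert_space operator \<Rightarrow> 'a operator \<Rightarrow> bool"
    (infix \<open>\<preceq>\<close> 50) where
  "A \<preceq> B \<longleftrightarrow> B - A \<in> pos_ops"

definition sot_decreasing_to ::
    "(nat \<Rightarrow> 'a::complex_hilbert_space operator) \<Rightarrow> 'a operator \<Rightarrow> bool"
    (infix \<open>\<searrow>\<close> 50) where
  "T \<searrow> L \<longleftrightarrow>
     (\<forall>k. T (Suc k) \<preceq> T k) \<and>
     (\<forall>x. (\<lambda>k. blinfun_apply (T k) x) \<longlonglongrightarrow> blinfun_apply L x)"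

text \<open>
  Operator means in the sense of Kubo and Ando. A mean is a map on pairs of positive operators;
  the values of the underlying total function elsewhere are irrelevant.
\<close>

definition operator_mean ::
    "('a::complex_hilbert_space operator \<Rightarrow> 'a operator \<Rightarrow> 'a operator) \<Rightarrow> bool" where
  "operator_mean \<sigma> \<longleftrightarrow>
     (\<forall>A \<in> pos_ops. \<forall>B \<in> pos_ops. \<sigma> A B \<in> pos_ops) \<and>
     (\<forall>A \<in> pos_ops. \<forall>A' \<in> pos_ops. \<forall>B \<in> pos_ops. \<forall>B' \<in> pos_ops.
        A \<preceq> A' \<longrightarrow> B \<preceq> B' \<longrightarrow> \<sigma> A B \<preceq> \<sigma> A' B') \<and>
     (\<forall>A \<in> pos_ops. \<forall>B \<in> pos_ops. \<forall>C \<in> pos_ops.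
        C o\<^sub>L \<sigma> A B o\<^sub>L C \<preceq> \<sigma> (C o\<^sub>L A o\<^sub>L C) (C o\<^sub>L B o\<^sub>L C)) \<and>
     (\<forall>As Bs. \<forall>A \<in> pos_ops. \<forall>B \<in> pos_ops.
        (\<forall>k. As k \<in> pos_ops \<and> Bs k \<in> pos_ops) \<longrightarrow>
        As \<searrow> A \<longrightarrow> Bs \<searrow> B \<longrightarrow> (\<lambda>k. \<sigma> (As k) (Bs k)) \<searrow> \<sigma> A B) \<and>
     \<sigma> id_blinfun id_blinfun = id_blinfun"

definition left_trivial_mean :: "'a operator \<Rightarrow> 'a operator \<Rightarrow> 'a::complex_hilbert_space operator" where
  "left_trivial_mean A B = A"

definition means_equal ::
    "('a::complex_hilbert_space operator \<Rightarrow> 'a operator \<Rightarrow> 'a operator) \<Rightarrow>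
     ('a operator \<Rightarrow> 'a operator \<Rightarrow> 'a operator) \<Rightarrow> bool" where
  "means_equal \<sigma> \<tau> \<longleftrightarrow> (\<forall>A \<in> pos_ops. \<forall>B \<in> pos_ops. \<sigma> A B = \<tau> A B)"

end

theory Submission
  imports Defs
begin

text \<open>
  Existence: the map \<open>F(X) = (X \<sigma> A) \<tau> (X \<sigma> B)\<close> is monotone and sends an order interval
  \<open>[k I, m I]\<close> containing \<open>A\<close> and \<open>B\<close> into itself, so its iterates starting at \<open>m I\<close> decrease
  strongly to a fixed point by axiom (III).

  Uniqueness: if \<open>X \<le> \<lambda> Y\<close> for two fixed points with \<open>\<lambda> > 1\<close> minimal, then
  \<open>X \<le> F(\<lambda> Y) = \<lambda> (Y \<sigma> \<lambda>\<^sup>-\<^sup>1A) \<tau> (Y \<sigma> \<lambda>\<^sup>-\<^sup>1B)\<close>, which contradicts minimality as soon as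
  \<open>Y \<sigma> sA \<le> c (Y \<sigma> A)\<close> with some \<open>c < 1\<close> for every \<open>s < 1\<close>. This strictness needs neither the
  functional calculus nor square roots. Rank-one compressions yield \<open>Y \<sigma> bY = f(b) Y\<close>, and
  a direction that escapes to infinity serves as an additional dimension to prove
  \<open>(Y \<sigma> A) + f(b) R \<le> (1 + \<eta>) ((Y + R) \<sigma> (A + b R))\<close> for rank-one \<open>R\<close>. Splitting a small \<open>R \<le> \<epsilon>Y\<close>
  off \<open>Y\<close> and a multiple \<open>b R\<close> off \<open>A\<close> then gains \<open>\<epsilon> f(b)\<close> and loses almost exactly
  \<open>\<epsilon> f(K)\<close>, where \<open>A \<le> K Y\<close>. Finally \<open>f(b) > f(K)\<close> for some \<open>b\<close>, because an operator
  monotone function that is eventually constant is constant, and \<open>f\<close> constant means that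
  \<open>\<sigma>\<close> is the left trivial mean.
\<close>

section \<open>Sesquilinearity of the inner product and the norm\<close>

lemma cinner_add_left: "cinner (x + y) z = cinner x z + cinner y (z :: 'a::complex_hilbert_space)"
  by (metis cinner_commute cinner_add_right complex_cnj_add)

lemma cinner_scaleC_left: "cinner (c *\<^sub>C x) y = cnj c * cinner x (y :: 'a::complex_hilbert_space)"
  by (metis cinner_commute cinner_scaleC_right complex_cnj_mult)

lemma cinner_scaleR_right: "cinner x (r *\<^sub>R y) = of_real r * cinner x (y :: 'a::complex_hilbert_space)"
  by (simp add: scaleR_eq_scaleC cinner_scaleC_right)

lemma cinner_scaleR_left: "cinner (r *\<^sub>R x) y = of_real r * cinner x (y :: 'a::complex_hilbert_space)"
  by (simp add: scaleR_eq_scaleC cinner_scaleC_left)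

lemma cinner_minus_right: "cinner x (- y) = - cinner x (y :: 'a::complex_hilbert_space)"
  using cinner_scaleR_right[of x "-1" y] by simp

lemma cinner_minus_left: "cinner (- x) y = - cinner x (y :: 'a::complex_hilbert_space)"
  using cinner_scaleR_left[of "-1" x y] by simp

lemma cinner_diff_right: "cinner x (y - z) = cinner x y - cinner x (z :: 'a::complex_hilbert_space)"
  using cinner_add_right[of x y "- z"] by (simp add: cinner_minus_right)

lemma cinner_diff_left: "cinner (x - y) z = cinner x z - cinner y (z :: 'a::complex_hilbert_space)"
  using cinner_add_left[of x "- y" z] by (simp add: cinner_minus_left)

lemma cinner_zero_right [simp]: "cinner x (0 :: 'a::complex_hilbert_space) = 0"
  using cinner_diff_right[of x x x] by simp

lemma cinner_zero_left [simp]: "cinner (0 :: 'a::complex_hilbert_space) x = 0"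
  using cinner_diff_left[of x x x] by simp

lemma cinner_sum_right: "cinner x (\<Sum>i\<in>I. f i) = (\<Sum>i\<in>I. cinner x (f i :: 'a::complex_hilbert_space))"
  by (induction I rule: infinite_finite_induct) (auto simp: cinner_add_right)

lemma cinner_self: "cinner x x = complex_of_real ((norm (x :: 'a::complex_hilbert_space))\<^sup>2)"
proof -
  have "Im (cinner x x) = 0"
    using arg_cong[OF cinner_commute[of x x], of Im] by simp
  thus ?thesis
    by (simp add: complex_eq_iff norm_eq_sqrt_cinner cinner_self_nonneg)
qed

lemma cmod_cinner_self: "cmod (cinner x x) = (norm (x :: 'a::complex_hilbert_space))\<^sup>2"
  by (simp add: cinner_self norm_power)

lemma scaleC_diff_right: "c *\<^sub>C (x - y) = c *\<^sub>C x - c *\<^sub>C (y :: 'a::complex_hilbert_space)"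
  by (rule complex_vector.scale_right_diff_distrib)

lemma scaleC_scaleR: "c *\<^sub>C (r *\<^sub>R x) = r *\<^sub>R (c *\<^sub>C (x :: 'a::complex_hilbert_space))"
  by (simp add: scaleR_eq_scaleC scaleC_scaleC mult.commute)

lemma norm_scaleC: "norm (c *\<^sub>C (x :: 'a::complex_hilbert_space)) = cmod c * norm x"
proof -
  have "complex_of_real ((norm (c *\<^sub>C x))\<^sup>2) = cnj c * c * complex_of_real ((norm x)\<^sup>2)"
    unfolding cinner_self[symmetric] by (simp add: cinner_scaleC_left cinner_scaleC_right)
  also have "cnj c * c = complex_of_real ((cmod c)\<^sup>2)"
    using complex_norm_square[of c] by (simp add: mult.commute)
  finally have "complex_of_real ((norm (c *\<^sub>C x))\<^sup>2) = complex_of_real ((cmod c * norm x)\<^sup>2)"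
    by (simp add: power_mult_distrib)
  hence "(norm (c *\<^sub>C x))\<^sup>2 = (cmod c * norm x)\<^sup>2"
    by (simp only: of_real_eq_iff)
  thus ?thesis by (subst (asm) power2_eq_iff_nonneg) auto
qed

section \<open>Positive operators\<close>

text \<open>The operator order is handled through these real quadratic forms. Taking the real part
  makes the form real for every operator; for positive operators it loses nothing
  (\<open>pos_ops_cinner\<close>).\<close>

definition qform :: "'a::complex_hilbert_space operator \<Rightarrow> 'a \<Rightarrow> real" where
  "qform T x = Re (cinner x (T x))"

lemma bounded_opsD: "T \<in> bounded_ops \<Longrightarrow> T (c *\<^sub>C x) = c *\<^sub>C T x"
  by (simp add: bounded_ops_def)

lemma bounded_ops_id [simp]: "id_blinfun \<in> bounded_ops"
  and bounded_ops_zero [simp]: "0 \<in> bounded_ops"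
  and bounded_ops_add [simp]: "S \<in> bounded_ops \<Longrightarrow> T \<in> bounded_ops \<Longrightarrow> S + T \<in> bounded_ops"
  and bounded_ops_diff [simp]: "S \<in> bounded_ops \<Longrightarrow> T \<in> bounded_ops \<Longrightarrow> S - T \<in> bounded_ops"
  and bounded_ops_scaleR [simp]: "T \<in> bounded_ops \<Longrightarrow> r *\<^sub>R T \<in> bounded_ops"
  and bounded_ops_compose [simp]: "S \<in> bounded_ops \<Longrightarrow> T \<in> bounded_ops \<Longrightarrow> S o\<^sub>L T \<in> bounded_ops"
  by (auto simp: bounded_ops_def blinfun.add_left blinfun.diff_left blinfun.scaleR_left
      scaleC_add_right scaleC_diff_right scaleC_scaleR)

lemma pos_ops_bounded: "T \<in> pos_ops \<Longrightarrow> T \<in> bounded_ops"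
  by (simp add: pos_ops_def)

lemma pos_ops_cinner: "T \<in> pos_ops \<Longrightarrow> cinner x (T x) = complex_of_real (qform T x)"
  by (auto simp: pos_ops_def qform_def complex_eq_iff complex_is_Real_iff)

lemma qform_nonneg: "T \<in> pos_ops \<Longrightarrow> 0 \<le> qform T x"
  by (simp add: pos_ops_def qform_def)

lemma pos_opsI:
  assumes "T \<in> bounded_ops" "\<And>x. cinner x (T x) = complex_of_real (h x)" "\<And>x. 0 \<le> h x"
  shows "T \<in> pos_ops"
  using assms by (simp add: pos_ops_def)

lemma qform_id [simp]: "qform id_blinfun x = (norm x)\<^sup>2"
  and qform_zero [simp]: "qform 0 x = 0"
  and qform_add: "qform (S + T) x = qform S x + qform T x"
  and qform_diff: "qform (S - T) x = qform S x - qform T x"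
  and qform_scaleR: "qform (r *\<^sub>R T) x = r * qform T x"
  by (simp_all add: qform_def cinner_self blinfun.add_left blinfun.diff_left blinfun.scaleR_left
      cinner_add_right cinner_diff_right cinner_scaleR_right)

lemma qform_zero_vec [simp]: "qform T 0 = 0"
  by (simp add: qform_def)

lemma pos_ops_id [simp]: "id_blinfun \<in> pos_ops"
  by (rule pos_opsI[where h = "\<lambda>x. (norm x)\<^sup>2"]) (auto simp: cinner_self)

lemma pos_ops_zero [simp]: "0 \<in> pos_ops"
  by (rule pos_opsI[where h = "\<lambda>x. 0"]) auto

lemma pos_ops_add [simp]: "S \<in> pos_ops \<Longrightarrow> T \<in> pos_ops \<Longrightarrow> S + T \<in> pos_ops"
  by (rule pos_opsI[where h = "\<lambda>x. qform S x + qform T x"])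
    (auto simp: pos_ops_bounded blinfun.add_left cinner_add_right pos_ops_cinner qform_nonneg)

lemma pos_ops_scaleR [simp]: "T \<in> pos_ops \<Longrightarrow> 0 \<le> r \<Longrightarrow> r *\<^sub>R T \<in> pos_ops"
  by (rule pos_opsI[where h = "\<lambda>x. r * qform T x"])
    (auto simp: pos_ops_bounded blinfun.scaleR_left cinner_scaleR_right pos_ops_cinner qform_nonneg)

lemma op_le_iff:
  assumes "S \<in> pos_ops" "T \<in> pos_ops"
  shows "S \<preceq> T \<longleftrightarrow> (\<forall>x. qform S x \<le> qform T x)"
proof
  assume "S \<preceq> T"
  hence "0 \<le> qform (T - S) x" for x
    by (simp add: op_le_def qform_nonneg)
  thus "\<forall>x. qform S x \<le> qform T x"
    by (simp add: qform_diff)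
next
  assume "\<forall>x. qform S x \<le> qform T x"
  thus "S \<preceq> T" unfolding op_le_def
    by (intro pos_opsI[where h = "\<lambda>x. qform T x - qform S x"])
      (auto simp: assms pos_ops_bounded blinfun.diff_left cinner_diff_right pos_ops_cinner)
qed

text \<open>Polarisation: the form is real at x + y and at x + iy, which fixes the imaginary and the
  real part of \<open>cinner x (T y)\<close> respectively.\<close>

lemma pos_ops_hermitian:
  assumes "T \<in> pos_ops"
  shows "cinner x (T y) = cinner (T x) y"
proof -
  have im: "Im (cinner w (T w)) = 0" for w
    using pos_ops_cinner[OF assms] by simp
  have lin: "T (u + v) = T u + T v" "T (c *\<^sub>C u) = c *\<^sub>C T u" for u v c
    by (simp_all add: blinfun.add_right bounded_opsD[OF pos_ops_bounded[OF assms]])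
  have "Im (cinner x (T y)) + Im (cinner y (T x)) = 0"
    using im[of "x + y"] im[of x] im[of y] by (simp add: lin cinner_add_left cinner_add_right)
  moreover have "Re (cinner x (T y)) - Re (cinner y (T x)) = 0"
    using im[of "x + \<i> *\<^sub>C y"] im[of x] im[of y]
    by (simp add: lin cinner_add_left cinner_add_right cinner_scaleC_left cinner_scaleC_right)
  ultimately have "cinner x (T y) = cnj (cinner y (T x))"
    by (simp add: complex_eq_iff)
  thus ?thesis by (metis cinner_commute)
qed

lemma qform_add_vec:
  assumes "T \<in> pos_ops"
  shows "qform T (x + y) = qform T x + 2 * Re (cinner x (T y)) + qform T y"
proof -
  have "Re (cinner y (T x)) = Re (cinner x (T y))"
    using pos_ops_hermitian[OF assms, of x y] cinner_commute[of "T x" y] by simp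
  thus ?thesis
    by (simp add: qform_def blinfun.add_right cinner_add_left cinner_add_right)
qed

lemma qform_scaleC_vec:
  assumes "T \<in> pos_ops"
  shows "qform T (c *\<^sub>C x) = (cmod c)\<^sup>2 * qform T x"
proof -
  have "cinner (c *\<^sub>C x) (T (c *\<^sub>C x)) = (c * cnj c) * cinner x (T x)"
    by (simp add: bounded_opsD[OF pos_ops_bounded[OF assms]] cinner_scaleC_left cinner_scaleC_right)
  also have "\<dots> = complex_of_real ((cmod c)\<^sup>2) * cinner x (T x)"
    by (simp add: complex_norm_square del: of_real_power)
  finally show ?thesis
    by (simp add: qform_def del: of_real_power)
qed

lemma qform_scaleR_vec:
  assumes "T \<in> pos_ops"
  shows "qform T (r *\<^sub>R x) = r\<^sup>2 * qform T x"
  using qform_scaleC_vec[OF assms, of "of_real r" x] by (simp add: scaleR_eq_scaleC)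

text \<open>Positivity of the form at x + c y, with the phase of c chosen to make the cross term
  real and negative, gives a quadratic inequality in t.\<close>

lemma pos_ops_Cauchy_Schwarz:
  assumes "T \<in> pos_ops"
  shows "(cmod (cinner x (T y)))\<^sup>2 \<le> qform T x * qform T y"
proof -
  define h where "h = cinner x (T y)"
  have *: "0 \<le> qform T x - 2 * t * (cmod h)\<^sup>2 + t\<^sup>2 * (cmod h)\<^sup>2 * qform T y" for t :: real
  proof -
    define c where "c = - (of_real t * cnj h)"
    have "cinner x (T (c *\<^sub>C y)) = c * h"
      by (simp add: bounded_opsD[OF pos_ops_bounded[OF assms]] cinner_scaleC_right h_def)
    also have "c * h = - of_real (t * (cmod h)\<^sup>2)"
      using complex_norm_square[of h] by (simp add: c_def algebra_simps)
    finally have "Re (cinner x (T (c *\<^sub>C y))) = - (t * (cmod h)\<^sup>2)" by simp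
    moreover have "(cmod c)\<^sup>2 = t\<^sup>2 * (cmod h)\<^sup>2"
      by (simp add: c_def norm_mult power_mult_distrib)
    ultimately show ?thesis
      using qform_nonneg[OF assms, of "x + c *\<^sub>C y"]
      by (simp add: qform_add_vec[OF assms] qform_scaleC_vec[OF assms])
  qed
  show ?thesis
  proof (cases "qform T y = 0")
    case True
    have "(cmod h)\<^sup>2 \<le> 0"
    proof (rule ccontr)
      assume "\<not> (cmod h)\<^sup>2 \<le> 0"
      \<comment> \<open>The inequality is now affine in t; this t makes its right-hand side equal to
        -1.\<close>
      thus False using *[of "(qform T x + 1) / (2 * (cmod h)\<^sup>2)"] True by (simp add: field_simps)
    qed
    thus ?thesis using True by (simp add: h_def)
  next
    case False
    hence "0 < qform T y" using qform_nonneg[OF assms, of y] by simp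
    thus ?thesis using *[of "1 / qform T y"]
      by (simp add: h_def field_simps power2_eq_square)
  qed
qed

lemma cinner_Cauchy_Schwarz: "cmod (cinner x y) \<le> norm x * norm (y :: 'a::complex_hilbert_space)"
proof (rule power2_le_imp_le)
  show "(cmod (cinner x y))\<^sup>2 \<le> (norm x * norm y)\<^sup>2"
    using pos_ops_Cauchy_Schwarz[OF pos_ops_id, of x y] by (simp add: power_mult_distrib)
qed auto

lemma qform_le_norm: "qform T x \<le> norm T * (norm x)\<^sup>2"
proof -
  have "qform T x \<le> norm x * norm (T x)"
    unfolding qform_def by (rule order.trans[OF complex_Re_le_cmod cinner_Cauchy_Schwarz])
  also have "\<dots> \<le> norm x * (norm T * norm x)"
    by (intro mult_left_mono norm_blinfun) auto
  finally show ?thesis by (simp add: power2_eq_square algebra_simps)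
qed

text \<open>The form version of \<open>T T \<le> M T\<close>: Cauchy-Schwarz at the pair T x, x,
  followed by cancelling one factor \<open>(norm (T x))\<^sup>2\<close>. It converts smallness of
  forms into smallness of vectors.\<close>

lemma norm_pos_op_le:
  assumes "T \<in> pos_ops" "0 \<le> M" and le: "\<And>x. qform T x \<le> M * (norm x)\<^sup>2"
  shows "(norm (T x))\<^sup>2 \<le> M * qform T x"
proof -
  have "((norm (T x))\<^sup>2)\<^sup>2 \<le> qform T (T x) * qform T x"
    using pos_ops_Cauchy_Schwarz[OF assms(1), of "T x" x] by (simp add: cmod_cinner_self)
  also have "\<dots> \<le> (M * (norm (T x))\<^sup>2) * qform T x"
    by (intro mult_right_mono le qform_nonneg assms)
  finally have "(norm (T x))\<^sup>2 * (norm (T x))\<^sup>2 \<le> (norm (T x))\<^sup>2 * (M * qform T x)"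
    by (simp add: power2_eq_square algebra_simps)
  moreover have "0 \<le> M * qform T x" by (intro mult_nonneg_nonneg qform_nonneg assms)
  ultimately show ?thesis
    by (cases "T x = 0") (simp, blast intro: mult_left_le_imp_le zero_less_power zero_less_norm_iff[THEN iffD2])
qed

lemma pos_op_apply_eq_0:
  assumes "T \<in> pos_ops" "qform T x = 0"
  shows "T x = 0"
  using norm_pos_op_le[OF assms(1) norm_ge_zero[of T] qform_le_norm, of x] assms(2) by simp

lemma op_le_antisym:
  assumes "S \<in> pos_ops" "T \<in> pos_ops" "S \<preceq> T" "T \<preceq> S"
  shows "S = T"
proof (rule blinfun_eqI)
  fix x
  have "qform (T - S) x = 0"
    using assms by (simp add: op_le_iff qform_diff antisym)
  moreover have "T - S \<in> pos_ops" using assms(3) by (simp add: op_le_def)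
  ultimately have "(T - S) x = 0" by (rule pos_op_apply_eq_0[rotated])
  thus "S x = T x" by (simp add: blinfun.diff_left)
qed

lemma pos_ops_sandwich [simp]:
  assumes "C \<in> pos_ops" "T \<in> pos_ops"
  shows "C o\<^sub>L T o\<^sub>L C \<in> pos_ops"
  by (rule pos_opsI[where h = "\<lambda>x. qform T (C x)"])
    (auto simp: assms pos_ops_bounded pos_ops_hermitian[OF assms(1)] pos_ops_cinner qform_nonneg)

lemma qform_sandwich:
  assumes "C \<in> pos_ops"
  shows "qform (C o\<^sub>L T o\<^sub>L C) x = qform T (C x)"
  by (simp add: qform_def pos_ops_hermitian[OF assms])

lemma tendsto_cinner:
  assumes "(f \<longlongrightarrow> a) F" "(g \<longlongrightarrow> (b :: 'a::complex_hilbert_space)) F"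
  shows "((\<lambda>n. cinner (f n) (g n)) \<longlongrightarrow> cinner a b) F"
proof -
  have "bounded_bilinear (cinner :: 'a \<Rightarrow> 'a \<Rightarrow> complex)"
    by unfold_locales
      (auto simp: cinner_add_left cinner_add_right cinner_scaleR_left cinner_scaleR_right
        scaleR_conv_of_real intro!: exI[of _ 1] cinner_Cauchy_Schwarz)
  from bounded_bilinear.tendsto[OF this assms] show ?thesis .
qed

lemma tendsto_qform:
  assumes "(\<lambda>n. blinfun_apply (T n) x) \<longlonglongrightarrow> blinfun_apply L x"
  shows "(\<lambda>n. qform (T n) x) \<longlonglongrightarrow> qform L x"
  unfolding qform_def by (intro tendsto_Re tendsto_cinner tendsto_const assms)

lemma tendsto_qform_vec:
  assumes "w \<longlonglongrightarrow> x"
  shows "(\<lambda>n. qform T (w n)) \<longlonglongrightarrow> qform T x"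
  unfolding qform_def by (intro tendsto_Re tendsto_cinner blinfun.tendsto tendsto_const assms)

section \<open>Positive invertible operators are the positive operators bounded below\<close>

lemma pos_inv_ops_bounded_below:
  assumes "T \<in> pos_inv_ops"
  obtains k where "k > 0" "\<And>x. k * (norm x)\<^sup>2 \<le> qform T x"
proof -
  from assms obtain S where T: "T \<in> pos_ops" and S: "T o\<^sub>L S = id_blinfun"
    by (auto simp: pos_inv_ops_def invertible_op_def)
  have TS: "T (S x) = x" for x
    using arg_cong[OF S, of "\<lambda>U. blinfun_apply U x"] by simp
  \<comment> \<open>Cauchy-Schwarz at the pair x, S x, where T (S x) = x. The summand 1 keeps the
    later division by the constant legitimate even if S = 0.\<close>
  have "(norm x)\<^sup>2 \<le> (norm S + 1) * qform T x" for x
  proof -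
    have "((norm x)\<^sup>2)\<^sup>2 \<le> qform T x * qform T (S x)"
      using pos_ops_Cauchy_Schwarz[OF T, of x "S x"] by (simp add: TS cmod_cinner_self)
    also have "qform T (S x) = qform S x"
      using cinner_commute[of "S x" x] by (simp add: qform_def TS)
    also have "qform T x * qform S x \<le> qform T x * (norm S * (norm x)\<^sup>2)"
      by (intro mult_left_mono qform_le_norm qform_nonneg T)
    also have "\<dots> \<le> qform T x * ((norm S + 1) * (norm x)\<^sup>2)"
      by (intro mult_left_mono mult_right_mono qform_nonneg T) auto
    finally have "(norm x)\<^sup>2 * (norm x)\<^sup>2 \<le> (norm x)\<^sup>2 * ((norm S + 1) * qform T x)"
      by (simp add: power2_eq_square algebra_simps)
    thus ?thesis
      by (cases "x = 0") (simp, erule mult_left_le_imp_le, simp)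
  qed
  hence "1 / (norm S + 1) * (norm x)\<^sup>2 \<le> qform T x" for x
    by (simp add: field_simps add_pos_nonneg)
  thus ?thesis using that[of "1 / (norm S + 1)"] by (simp add: add_nonneg_pos)
qed

text \<open>The operator D = I - T/M is positive with D at most \<rho> < 1, hence a strict
  contraction, and T w = y is the fixed point equation w = D w + y/M. The lower bound also gives
  injectivity and a bounded inverse.\<close>

lemma bounded_below_pos_inv_ops:
  fixes T :: "'a::complex_hilbert_space operator"
  assumes T: "T \<in> pos_ops" and "k > 0" and low: "\<And>x. k * (norm x)\<^sup>2 \<le> qform T x"
  shows "T \<in> pos_inv_ops"
proof -
  define M where "M = norm T + k"
  define D where "D = id_blinfun - (1 / M) *\<^sub>R T"
  define \<rho> where "\<rho> = 1 - k / M"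
  have M: "M > 0" "k \<le> M" using \<open>k > 0\<close> by (auto simp: M_def add_nonneg_pos)
  have \<rho>: "0 \<le> \<rho>" "\<rho> < 1" using M \<open>k > 0\<close> by (auto simp: \<rho>_def)
  have "qform T x / M \<le> (norm x)\<^sup>2" for x
    using qform_le_norm[of T x] \<open>k > 0\<close> M
    by (simp add: field_simps M_def) (smt (verit) mult_nonneg_nonneg zero_le_power2)
  hence D: "D \<in> pos_ops"
    using op_le_iff[of "(1 / M) *\<^sub>R T" id_blinfun] T M by (simp add: D_def op_le_def qform_scaleR)
  have D_le: "qform D x \<le> \<rho> * (norm x)\<^sup>2" for x
    using low[of x] M by (simp add: D_def qform_diff qform_scaleR \<rho>_def field_simps)
  have norm_D: "norm (D x) \<le> \<rho> * norm x" for x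
  proof (rule power2_le_imp_le)
    have "(norm (D x))\<^sup>2 \<le> \<rho> * qform D x"
      by (rule norm_pos_op_le[OF D \<rho>(1) D_le])
    also have "\<dots> \<le> \<rho> * (\<rho> * (norm x)\<^sup>2)"
      by (intro mult_left_mono D_le \<rho>)
    finally show "(norm (D x))\<^sup>2 \<le> (\<rho> * norm x)\<^sup>2"
      by (simp add: power2_eq_square algebra_simps)
  qed (use \<rho> in auto)
  have low': "k * norm x \<le> norm (T x)" for x
  proof (cases "x = 0")
    case False
    have "k * (norm x)\<^sup>2 \<le> norm x * norm (T x)"
      using low[of x] order.trans[OF complex_Re_le_cmod cinner_Cauchy_Schwarz, of x "T x"]
      by (simp add: qform_def)
    thus ?thesis using False by (simp add: power2_eq_square)
  qed auto
  have ex: "\<exists>w. T w = y" for y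
  proof -
    have "\<exists>!w\<in>UNIV. D w + (1 / M) *\<^sub>R y = w"
    proof (rule Banach_fix[where c = \<rho>])
      fix u v :: 'a
      have "dist (D u + (1 / M) *\<^sub>R y) (D v + (1 / M) *\<^sub>R y) = norm (D (u - v))"
        by (simp add: dist_norm blinfun.diff_right)
      also have "\<dots> \<le> \<rho> * dist u v" using norm_D[of "u - v"] by (simp add: dist_norm)
      finally show "dist (D u + (1 / M) *\<^sub>R y) (D v + (1 / M) *\<^sub>R y) \<le> \<rho> * dist u v" .
    qed (use \<rho> in \<open>auto simp: complete_UNIV\<close>)
    then obtain w where "D w + (1 / M) *\<^sub>R y = w" by blast
    hence "(1 / M) *\<^sub>R y = (1 / M) *\<^sub>R T w"
      by (simp add: D_def blinfun.diff_left blinfun.scaleR_left algebra_simps)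
    thus ?thesis using M by auto
  qed
  have inj: "u = v" if "T u = T v" for u v
    using low'[of "u - v"] that \<open>k > 0\<close>
    by (simp add: blinfun.diff_right) (metis norm_le_zero_iff mult_le_0_iff not_less right_minus_eq)
  define g where "g y = (THE w. T w = y)" for y
  have Tg: "T (g y) = y" for y
    unfolding g_def by (rule theI') (use ex inj in blast)
  have gT: "g (T w) = w" for w
    using Tg inj by blast
  have lin: "bounded_linear g"
  proof (rule bounded_linear_intro[where K = "1 / k"])
    show "g (x + y) = g x + g y" for x y
      by (rule inj) (simp add: Tg blinfun.add_right)
    show "g (r *\<^sub>R x) = r *\<^sub>R g x" for r x
      by (rule inj) (simp add: Tg blinfun.scaleR_right)
    show "norm (g x) \<le> norm x * (1 / k)" for x
      using low'[of "g x"] \<open>k > 0\<close> by (simp add: Tg field_simps)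
  qed
  have ap: "blinfun_apply (Blinfun g) = g"
    by (rule bounded_linear_Blinfun_apply[OF lin])
  have "g (c *\<^sub>C x) = c *\<^sub>C g x" for c x
    by (rule inj) (simp add: Tg bounded_opsD[OF pos_ops_bounded[OF T]])
  hence "Blinfun g \<in> bounded_ops"
    by (simp add: bounded_ops_def ap)
  moreover have "T o\<^sub>L Blinfun g = id_blinfun" "Blinfun g o\<^sub>L T = id_blinfun"
    by (auto intro!: blinfun_eqI simp: ap Tg gT)
  ultimately show ?thesis
    using T by (auto simp: pos_inv_ops_def invertible_op_def)
qed

section \<open>Strong convergence of decreasing sequences of positive operators\<close>

lemma decreasing_le:
  assumes "\<And>n. T n \<in> pos_ops" "\<And>n. T (Suc n) \<preceq> T n" "m \<le> n"
  shows "qform (T n) x \<le> qform (T m) x"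
  using assms(3) by (rule lift_Suc_antimono_le[rotated]) (use assms in \<open>simp add: op_le_iff\<close>)

text \<open>The forms decrease and are nonnegative, hence converge. Applying
  \<open>norm_pos_op_le\<close> to the positive differences T m - T n, with one M for all of them,
  turns this into Cauchyness of the vectors T n x.\<close>

lemma Vigier:
  fixes T :: "nat \<Rightarrow> 'a::complex_hilbert_space operator"
  assumes pos: "\<And>n. T n \<in> pos_ops" and dec: "\<And>n. T (Suc n) \<preceq> T n"
  obtains L where "L \<in> pos_ops" "T \<searrow> L" "\<And>n x. qform L x \<le> qform (T n) x"
proof -
  define M where "M = norm (T 0)"
  have mono: "m \<le> n \<Longrightarrow> qform (T n) x \<le> qform (T m) x" for m n x
    by (rule decreasing_le[of T, OF pos dec])
  have up: "qform (T n) x \<le> M * (norm x)\<^sup>2" for n x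
    using mono[of 0 n x] qform_le_norm[of "T 0" x] by (simp add: M_def)
  have M: "0 \<le> M" by (simp add: M_def)
  have norm_T: "norm (T n x) \<le> M * norm x" for n x
  proof (rule power2_le_imp_le)
    have "(norm (T n x))\<^sup>2 \<le> M * qform (T n) x"
      by (rule norm_pos_op_le[OF pos M up])
    also have "\<dots> \<le> M * (M * (norm x)\<^sup>2)" by (intro mult_left_mono up M)
    finally show "(norm (T n x))\<^sup>2 \<le> (M * norm x)\<^sup>2"
      by (simp add: power2_eq_square algebra_simps)
  qed (use M in auto)
  have diff: "(norm (T m x - T n x))\<^sup>2 \<le> M * (qform (T m) x - qform (T n) x)" if "m \<le> n" for m n x
  proof -
    have "T m - T n \<in> pos_ops"
      using op_le_iff[OF pos pos] mono[OF that] by (simp add: op_le_def)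
    moreover have "qform (T m - T n) y \<le> M * (norm y)\<^sup>2" for y
      using up[of m y] qform_nonneg[OF pos, of n y] by (simp add: qform_diff)
    ultimately show ?thesis
      using norm_pos_op_le[OF _ M, of "T m - T n" x] by (simp add: qform_diff blinfun.diff_left)
  qed
  have conv: "convergent (\<lambda>n. T n x)" for x
  proof -
    have "decseq (\<lambda>n. qform (T n) x)" using mono by (auto simp: decseq_def)
    hence "Cauchy (\<lambda>n. qform (T n) x)"
      using decseq_convergent[of "\<lambda>n. qform (T n) x" 0] qform_nonneg[OF pos]
      by (metis LIMSEQ_imp_Cauchy)
    have "Cauchy (\<lambda>n. T n x)"
    proof (rule CauchyI')
      fix e :: real assume "e > 0"
      hence "e\<^sup>2 / (M + 1) > 0" using M by simp
      then obtain N where N: "\<And>m n. m \<ge> N \<Longrightarrow> n \<ge> N \<Longrightarrow> norm (qform (T m) x - qform (T n) x) < e\<^sup>2 / (M + 1)"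
        using CauchyD[OF \<open>Cauchy (\<lambda>n. qform (T n) x)\<close>] by blast
      show "\<exists>N. \<forall>m\<ge>N. \<forall>n>m. dist (T m x) (T n x) < e"
        unfolding dist_norm
      proof (intro exI allI impI)
        fix m n assume mn: "N \<le> m" "m < n"
        have "(norm (T m x - T n x))\<^sup>2 \<le> M * (qform (T m) x - qform (T n) x)"
          using mn by (intro diff) auto
        also have "\<dots> \<le> M * (e\<^sup>2 / (M + 1))"
          using N[of m n] mn M by (intro mult_left_mono) auto
        also have "\<dots> < e\<^sup>2" using M \<open>e > 0\<close> by (simp add: field_simps)
        finally show "norm (T m x - T n x) < e"
          using \<open>e > 0\<close> by (intro power2_less_imp_less[of _ e]) auto
      qed
    qed
    thus ?thesis by (rule Cauchy_convergent)
  qed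
  define l where "l x = lim (\<lambda>n. T n x)" for x
  have l: "(\<lambda>n. T n x) \<longlonglongrightarrow> l x" for x
    using conv[of x] by (simp add: l_def convergent_LIMSEQ_iff)
  have lin: "bounded_linear l"
  proof (rule bounded_linear_intro[where K = M])
    show "l (x + y) = l x + l y" for x y
      using tendsto_add[OF l[of x] l[of y]]
      by (intro LIMSEQ_unique[OF l[of "x + y"]]) (simp add: blinfun.add_right)
    show "l (r *\<^sub>R x) = r *\<^sub>R l x" for r x
      using tendsto_scaleR[OF tendsto_const l[of x], of r]
      by (intro LIMSEQ_unique[OF l[of "r *\<^sub>R x"]]) (simp add: blinfun.scaleR_right)
    show "norm (l x) \<le> norm x * M" for x
      by (rule Lim_bounded[OF tendsto_norm[OF l]]) (use norm_T in \<open>auto simp: mult.commute\<close>)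
  qed
  define L where "L = Blinfun l"
  have L: "blinfun_apply L = l"
    unfolding L_def by (rule bounded_linear_Blinfun_apply[OF lin])
  have "l (c *\<^sub>C x) = c *\<^sub>C l x" for c x
  proof (rule LIMSEQ_unique[OF l])
    have "bounded_linear (\<lambda>x :: 'a. c *\<^sub>C x)"
      by (rule bounded_linear_intro[where K = "cmod c"])
        (auto simp: scaleC_add_right scaleC_scaleR norm_scaleC)
    from bounded_linear.tendsto[OF this l[of x]]
    show "(\<lambda>n. T n (c *\<^sub>C x)) \<longlonglongrightarrow> c *\<^sub>C l x"
      by (simp add: bounded_opsD[OF pos_ops_bounded[OF pos]])
  qed
  hence "L \<in> bounded_ops" by (simp add: bounded_ops_def L)
  moreover have "cinner x (L x) = complex_of_real (qform L x)" for x
  proof -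
    have "(\<lambda>n. Im (cinner x (T n x))) \<longlonglongrightarrow> Im (cinner x (L x))"
      by (intro tendsto_Im tendsto_cinner tendsto_const) (simp add: L l)
    hence "Im (cinner x (L x)) = 0"
      by (simp add: pos_ops_cinner[OF pos] LIMSEQ_const_iff)
    thus ?thesis by (simp add: complex_eq_iff qform_def)
  qed
  moreover have q: "(\<lambda>n. qform (T n) x) \<longlonglongrightarrow> qform L x" for x
    by (rule tendsto_qform) (simp add: L l)
  moreover have "0 \<le> qform L x" for x
    by (rule LIMSEQ_le_const[OF q]) (use qform_nonneg[OF pos] in auto)
  ultimately have "L \<in> pos_ops" by (intro pos_opsI[where h = "qform L"])
  moreover have "T \<searrow> L" by (simp add: sot_decreasing_to_def dec L l)
  moreover have "qform L x \<le> qform (T n) x" for n x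
    by (rule LIMSEQ_le_const2[OF q]) (use mono in blast)
  ultimately show ?thesis using that by blast
qed

section \<open>Rank-one operators \<open>r s\<^sup>*\<close>; for a unit vector u,
  \<open>outer u u\<close> is the orthogonal projection onto its line\<close>

definition outer :: "'a::complex_hilbert_space \<Rightarrow> 'a \<Rightarrow> 'a operator" where
  "outer r s = Blinfun (\<lambda>w. cinner s w *\<^sub>C r)"

lemma outer_apply: "outer r s w = cinner s w *\<^sub>C r"
proof -
  have "bounded_linear (\<lambda>w. cinner s w *\<^sub>C r)"
    by (rule bounded_linear_intro[where K = "norm s * norm r"])
      (auto simp: cinner_add_right cinner_scaleC_right scaleC_add_left scaleR_eq_scaleC scaleC_scaleC
        norm_scaleC intro!: order.trans[OF mult_right_mono[OF cinner_Cauchy_Schwarz]])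
  thus ?thesis by (simp add: outer_def bounded_linear_Blinfun_apply)
qed

lemma outer_bounded [simp]: "outer r s \<in> bounded_ops"
  by (simp add: bounded_ops_def outer_apply cinner_scaleC_right scaleC_scaleC)

lemma cinner_outer_self: "cinner x (outer r r x) = complex_of_real ((cmod (cinner r x))\<^sup>2)"
proof -
  have "cinner x (outer r r x) = cinner r x * cnj (cinner r x)"
    using cinner_commute[of x r] by (simp add: outer_apply cinner_scaleC_right)
  thus ?thesis by (simp add: complex_norm_square del: of_real_power)
qed

lemma outer_pos [simp]: "outer r r \<in> pos_ops"
  by (rule pos_opsI[where h = "\<lambda>x. (cmod (cinner r x))\<^sup>2"]) (simp_all add: cinner_outer_self del: of_real_power)

lemma qform_outer: "qform (outer r r) x = (cmod (cinner r x))\<^sup>2"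
  by (simp add: qform_def cinner_outer_self del: of_real_power)

section \<open>Orthonormal sequences\<close>

text \<open>Gram-Schmidt: a finite orthonormal set never spans the space, and a vector outside its
  span minus its orthogonal expansion leaves a nonzero vector orthogonal to the set. Iterating the
  choice \<open>w\<close> gives the sequence.\<close>

lemma orthonormal_sequence:
  assumes "infinite_dimensional TYPE('a::complex_hilbert_space)"
  obtains z :: "nat \<Rightarrow> 'a::complex_hilbert_space" where "\<And>n. norm (z n) = 1" "\<And>m n. m \<noteq> n \<Longrightarrow> cinner (z m) (z n) = 0"
proof -
  define orth :: "'a set \<Rightarrow> bool" where
    "orth S \<longleftrightarrow> finite S \<and> (\<forall>u\<in>S. norm u = 1) \<and> (\<forall>u\<in>S. \<forall>v\<in>S. u \<noteq> v \<longrightarrow> cinner u v = 0)" for S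
  define w where "w S = (SOME w :: 'a. norm w = 1 \<and> (\<forall>u\<in>S. cinner u w = 0))" for S
  have w: "norm (w S) = 1 \<and> (\<forall>u\<in>S. cinner u (w S) = 0)" if S: "orth S" for S
  proof -
    have "complex_vector.span S \<noteq> UNIV"
      using assms S by (auto simp: infinite_dimensional_def orth_def)
    then obtain v where v: "v \<notin> complex_vector.span S" by blast
    define y where "y = v - (\<Sum>u\<in>S. cinner u v *\<^sub>C u)"
    have "(\<Sum>u\<in>S. cinner u v *\<^sub>C u) \<in> complex_vector.span S"
      by (intro complex_vector.span_sum complex_vector.span_scale complex_vector.span_base)
    with v have "y \<noteq> 0" by (auto simp: y_def)
    have "cinner u y = 0" if "u \<in> S" for u
    proof -
      have "(\<Sum>t\<in>S. cinner t v * cinner u t) = (\<Sum>t\<in>S. if t = u then cinner u v else 0)"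
        using S that by (intro sum.cong) (auto simp: orth_def cinner_self)
      also have "\<dots> = cinner u v" using S that by (simp add: orth_def)
      finally show ?thesis
        by (simp add: y_def cinner_diff_right cinner_sum_right cinner_scaleC_right)
    qed
    hence "norm ((1 / norm y) *\<^sub>R y) = 1 \<and> (\<forall>u\<in>S. cinner u ((1 / norm y) *\<^sub>R y) = 0)"
      using \<open>y \<noteq> 0\<close> by (simp add: cinner_scaleR_right)
    thus ?thesis unfolding w_def by (rule someI)
  qed
  define S where "S = rec_nat {} (\<lambda>_ X. insert (w X) X)"
  have S: "S 0 = {}" "S (Suc n) = insert (w (S n)) (S n)" for n
    by (simp_all add: S_def)
  have orth: "orth (S n)" for n
  proof (induction n)
    case (Suc n)
    have "cinner (w (S n)) u = 0" if "u \<in> S n" for u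
      using w[OF Suc] that cinner_commute[of "w (S n)" u] by simp
    thus ?case using Suc w[OF Suc] by (auto simp: S orth_def)
  qed (simp add: S orth_def)
  have S_mono: "m \<le> n \<Longrightarrow> S m \<subseteq> S n" for m n
    by (rule lift_Suc_mono_le[of S]) (auto simp: S)
  have less: "cinner (w (S m)) (w (S n)) = 0" if "m < n" for m n
    using w[OF orth[of n]] S_mono[of "Suc m" n] that by (auto simp: S)
  show ?thesis
  proof (rule that[of "\<lambda>n. w (S n)"])
    show "cinner (w (S m)) (w (S n)) = 0" if "m \<noteq> n" for m n
      using less[of m n] less[of n m] cinner_commute[of "w (S m)" "w (S n)"] that
      by (cases m n rule: linorder_cases) auto
  qed (use w orth in auto)
qed

lemma Bessel_inequality:
  fixes z :: "nat \<Rightarrow> 'a::complex_hilbert_space"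
  assumes "\<And>n. norm (z n) = 1" "\<And>m n. m \<noteq> n \<Longrightarrow> cinner (z m) (z n) = 0"
  shows "(\<Sum>k<n. (cmod (cinner (z k) x))\<^sup>2) \<le> (norm x)\<^sup>2"
proof -
  define c where "c k = cinner (z k) x" for k
  define s where "s = (\<Sum>k<n. c k *\<^sub>C z k)"
  define N where "N = (\<Sum>k<n. (cmod (c k))\<^sup>2)"
  have cs: "cinner y s = (\<Sum>k<n. c k * cinner y (z k))" for y
    by (simp add: s_def cinner_sum_right cinner_scaleC_right)
  have zs: "cinner (z j) s = c j" if "j < n" for j
  proof -
    have "cinner (z j) s = (\<Sum>k<n. if k = j then c j else 0)"
      unfolding cs by (intro sum.cong) (auto simp: cinner_self assms)
    thus ?thesis using that by simp
  qed
  have "cinner x s = (\<Sum>k<n. c k * cnj (c k))"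
    unfolding cs c_def by (intro sum.cong refl) (metis cinner_commute)
  hence xs: "cinner x s = of_real N"
    by (simp add: N_def complex_norm_square[symmetric] del: of_real_power)
  have "cinner s s = (\<Sum>k<n. c k * cnj (c k))"
    unfolding cs[of s] using zs cinner_commute[of s] by (intro sum.cong) auto
  hence ss: "cinner s s = of_real N"
    by (simp add: N_def complex_norm_square[symmetric] del: of_real_power)
  have sx: "cinner s x = of_real N"
    using cinner_commute[of s x] xs by simp
  have "0 \<le> Re (cinner (x - s) (x - s))" by (rule cinner_self_nonneg)
  hence "N \<le> (norm x)\<^sup>2"
    unfolding cinner_diff_left cinner_diff_right xs ss sx by (simp add: cinner_self)
  thus ?thesis by (simp add: N_def c_def)
qed

text \<open>A dominating sequence for the projections onto the z n that decreases strongly to 0, in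
  the form that axiom (III) accepts.\<close>

lemma orthonormal_tails:
  fixes z :: "nat \<Rightarrow> 'a::complex_hilbert_space"
  assumes "\<And>n. norm (z n) = 1" "\<And>m n. m \<noteq> n \<Longrightarrow> cinner (z m) (z n) = 0"
  obtains Q :: "nat \<Rightarrow> 'a operator" where "\<And>n. Q n \<in> pos_ops" "Q \<searrow> 0"
    "\<And>n x. (cmod (cinner (z n) x))\<^sup>2 \<le> qform (Q n) x"
proof -
  define U where "U n = (\<Sum>k<n. outer (z k) (z k))" for n
  have U: "U n \<in> pos_ops" for n
    unfolding U_def by (induction n) auto
  have qU: "qform (U n) x = (\<Sum>k<n. (cmod (cinner (z k) x))\<^sup>2)" for n x
    unfolding U_def by (induction n) (auto simp: qform_add qform_outer)
  define D where "D n = id_blinfun - U n" for n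
  have D: "D n \<in> pos_ops" for n
    using op_le_iff[OF U pos_ops_id, of n] Bessel_inequality[of z, OF assms]
    by (simp add: D_def op_le_def qU)
  have step: "D n - D (Suc n) = outer (z n) (z n)" for n
    by (simp add: D_def U_def)
  have "D (Suc n) \<preceq> D n" for n
    by (simp add: op_le_def step)
  from Vigier[of D, OF D this] obtain L where
    L: "L \<in> pos_ops" "D \<searrow> L" "\<And>n x. qform L x \<le> qform (D n) x" by blast
  show ?thesis
  \<comment> \<open>The sequence z may fail to be complete, so D n tends to a possibly nonzero L,
    which is subtracted. Since L is below D (n + 1), the difference D n - L still dominates
    \<open>D n - D (Suc n)\<close>, the projection onto z n.\<close>
  proof (rule that[of "\<lambda>n. D n - L"])
    show "D n - L \<in> pos_ops" for n
      using op_le_iff[OF L(1) D] L(3) by (simp add: op_le_def)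
    have "(\<lambda>n. (D n - L) x) \<longlonglongrightarrow> L x - L x" for x
      unfolding blinfun.diff_left using L(2) by (intro tendsto_diff tendsto_const) (simp add: sot_decreasing_to_def)
    thus "(\<lambda>n. D n - L) \<searrow> 0"
      by (simp add: sot_decreasing_to_def op_le_def step)
    show "(cmod (cinner (z n) x))\<^sup>2 \<le> qform (D n - L) x" for n x
      using L(3)[of x "Suc n"] arg_cong[OF step[of n], of "\<lambda>T. qform T x"]
      by (simp add: qform_diff qform_outer)
  qed
qed

text \<open>Normalising Y x gives a rank-one operator below Y, by Cauchy-Schwarz, that touches Y at
  x. Lower bounds at a single vector thereby reduce to rank-one operators, which have explicit
  square roots.\<close>

lemma rank_one_minorant:
  assumes "Y \<in> pos_ops"
  obtains r where "\<And>y. (cmod (cinner r y))\<^sup>2 \<le> qform Y y" "(cmod (cinner r x))\<^sup>2 = qform Y x"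
proof (cases "qform Y x = 0")
  case True
  thus ?thesis using that[of 0] qform_nonneg[OF assms] by simp
next
  case False
  define c where "c = qform Y x"
  have c: "c > 0" using False qform_nonneg[OF assms, of x] by (simp add: c_def)
  define r where "r = (1 / sqrt c) *\<^sub>R Y x"
  have r: "(cmod (cinner r y))\<^sup>2 = (cmod (cinner x (Y y)))\<^sup>2 / c" for y
    using c by (simp add: r_def cinner_scaleR_left pos_ops_hermitian[OF assms] norm_mult
        norm_divide power_mult_distrib power_divide)
  show ?thesis
  proof (rule that[of r])
    show "(cmod (cinner r y))\<^sup>2 \<le> qform Y y" for y
      using pos_ops_Cauchy_Schwarz[OF assms, of x y] c by (simp add: r c_def field_simps)
    show "(cmod (cinner r x))\<^sup>2 = qform Y x"
      unfolding r using c by (simp add: pos_ops_cinner[OF assms] c_def[symmetric] power2_eq_square)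
  qed
qed

lemma id_minus_outer_pos [simp]:
  assumes "norm u = 1"
  shows "id_blinfun - outer u u \<in> pos_ops"
proof -
  have "cmod (cinner u y) \<le> norm y" for y
    using cinner_Cauchy_Schwarz[of u y] assms by simp
  hence "(cmod (cinner u y))\<^sup>2 \<le> (norm y)\<^sup>2" for y
    by (simp add: power_mono)
  thus ?thesis
    using op_le_iff[OF outer_pos[of u] pos_ops_id] by (simp add: op_le_def qform_outer)
qed

lemma outer_unit_apply:
  assumes "norm u = 1"
  shows "outer u u u = u"
  by (simp add: outer_apply cinner_self assms scaleC_one)

lemma cmod_cinner_unit_le:
  assumes "norm u = 1"
  shows "(cmod (cinner u y))\<^sup>2 \<le> (norm y)\<^sup>2"
  using qform_nonneg[OF id_minus_outer_pos[OF assms], of y] by (simp add: qform_diff qform_outer)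

lemma sot_decreasing_const: "(\<lambda>n. T) \<searrow> T"
  by (simp add: sot_decreasing_to_def op_le_def)

lemma sot_decreasing_scale_add:
  assumes "T \<searrow> L" "0 \<le> c"
  shows "(\<lambda>n. S + c *\<^sub>R T n) \<searrow> S + c *\<^sub>R L"
proof -
  have "S + c *\<^sub>R T n - (S + c *\<^sub>R T (Suc n)) = c *\<^sub>R (T n - T (Suc n))" for n
    by (simp add: algebra_simps)
  thus ?thesis using assms
    by (auto simp: sot_decreasing_to_def op_le_def blinfun.add_left blinfun.scaleR_left
        intro!: tendsto_add tendsto_scaleR tendsto_const)
qed

section \<open>Means of multiples of one operator\<close>

text \<open>Infinite dimension is part of the locale because the arguments draw unit vectors,
  orthonormal pairs and an escaping sequence from \<open>orthonormal_sequence\<close>.\<close>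

locale kubo_ando_mean =
  fixes \<sigma> :: "'a::complex_hilbert_space operator \<Rightarrow> 'a operator \<Rightarrow> 'a operator"
  assumes mean: "operator_mean \<sigma>"
    and inf_dim: "infinite_dimensional TYPE('a)"
begin

lemma mean_pos [simp]: "A \<in> pos_ops \<Longrightarrow> B \<in> pos_ops \<Longrightarrow> \<sigma> A B \<in> pos_ops"
  using mean by (simp add: operator_mean_def)

lemma mean_mono:
  assumes "A \<in> pos_ops" "B \<in> pos_ops" "A' \<in> pos_ops" "B' \<in> pos_ops"
    and "\<And>x. qform A x \<le> qform A' x" "\<And>x. qform B x \<le> qform B' x"
  shows "qform (\<sigma> A B) x \<le> qform (\<sigma> A' B') x"
proof -
  have "\<sigma> A B \<preceq> \<sigma> A' B'"
    using mean assms by (simp add: operator_mean_def op_le_iff)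
  thus ?thesis using assms by (simp add: op_le_iff)
qed

lemma mean_transformer:
  assumes "A \<in> pos_ops" "B \<in> pos_ops" "C \<in> pos_ops"
  shows "qform (\<sigma> A B) (C x) \<le> qform (\<sigma> (C o\<^sub>L A o\<^sub>L C) (C o\<^sub>L B o\<^sub>L C)) x"
proof -
  have "C o\<^sub>L \<sigma> A B o\<^sub>L C \<preceq> \<sigma> (C o\<^sub>L A o\<^sub>L C) (C o\<^sub>L B o\<^sub>L C)"
    using mean assms by (simp add: operator_mean_def)
  thus ?thesis using assms by (simp add: op_le_iff qform_sandwich)
qed

lemma mean_decreasing:
  assumes "\<And>n. As n \<in> pos_ops" "\<And>n. Bs n \<in> pos_ops" "A \<in> pos_ops" "B \<in> pos_ops"
    and "As \<searrow> A" "Bs \<searrow> B"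
  shows "(\<lambda>n. \<sigma> (As n) (Bs n)) \<searrow> \<sigma> A B"
  using mean assms by (simp add: operator_mean_def)

lemma mean_id: "\<sigma> id_blinfun id_blinfun = id_blinfun"
  using mean by (simp add: operator_mean_def)

lemma unit_vector: obtains e :: 'a where "norm e = 1"
  using orthonormal_sequence[OF inf_dim] by metis

text \<open>Axiom (II) with C = sqrt t I gives one inequality; the same with 1/t in place of t gives
  the other.\<close>

lemma mean_scaleR:
  assumes "A \<in> pos_ops" "B \<in> pos_ops" "t > 0"
  shows "\<sigma> (t *\<^sub>R A) (t *\<^sub>R B) = t *\<^sub>R \<sigma> A B"
proof -
  have *: "t * qform (\<sigma> A B) x \<le> qform (\<sigma> (t *\<^sub>R A) (t *\<^sub>R B)) x"
    if "A \<in> pos_ops" "B \<in> pos_ops" "t > 0" for A B t x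
  proof -
    define C :: "'a operator" where "C = sqrt t *\<^sub>R id_blinfun"
    have C: "C o\<^sub>L A o\<^sub>L C = t *\<^sub>R A" for A
      using \<open>t > 0\<close> by (intro blinfun_eqI) (simp add: C_def blinfun.scaleR_left blinfun.scaleR_right)
    have "C \<in> pos_ops" using \<open>t > 0\<close> by (simp add: C_def)
    from mean_transformer[OF that(1,2) this, of x] show ?thesis
      using that by (simp add: C) (simp add: C_def blinfun.scaleR_left qform_scaleR_vec)
  qed
  have "qform (\<sigma> (t *\<^sub>R A) (t *\<^sub>R B)) x \<le> t * qform (\<sigma> A B) x" for x
    using *[of "t *\<^sub>R A" "t *\<^sub>R B" "1 / t" x] assms by (simp add: field_simps)
  thus ?thesis using *[OF assms] assms
    by (intro op_le_antisym) (auto simp: op_le_iff qform_scaleR)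
qed

text \<open>With \<open>P = u u\<^sup>*\<close> and \<open>T = A \<sigma> B\<close>, axiom (II) gives \<open>P T P \<le> T\<close>, so \<open>T - P T P\<close> is positive and
  vanishes at \<open>u\<close>.\<close>

lemma mean_eigenvector:
  assumes A: "A \<in> pos_ops" and B: "B \<in> pos_ops" and u: "norm u = 1"
    and "\<And>y. qform A (outer u u y) \<le> qform A y" "\<And>y. qform B (outer u u y) \<le> qform B y"
  shows "\<sigma> A B u = complex_of_real (qform (\<sigma> A B) u) *\<^sub>C u"
proof -
  define P where "P = outer u u"
  have P: "P \<in> pos_ops" "P u = u" by (simp_all add: P_def outer_unit_apply[OF u])
  have le: "qform (\<sigma> A B) (P y) \<le> qform (\<sigma> A B) y" for y
    using assms P
    by (intro order.trans[OF mean_transformer[OF A B P(1)] mean_mono]) (auto simp: qform_sandwich P_def)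
  define T where "T = \<sigma> A B - (P o\<^sub>L \<sigma> A B o\<^sub>L P)"
  have "P o\<^sub>L \<sigma> A B o\<^sub>L P \<preceq> \<sigma> A B"
    using A B P le by (simp add: op_le_iff qform_sandwich)
  hence "T \<in> pos_ops" by (simp add: T_def op_le_def)
  moreover have "qform T u = 0"
    by (simp add: T_def qform_diff qform_sandwich P)
  ultimately have "T u = 0" by (rule pos_op_apply_eq_0)
  hence "\<sigma> A B u = P (\<sigma> A B u)" by (simp add: T_def blinfun.diff_left P)
  also have "\<dots> = complex_of_real (qform (\<sigma> A B) u) *\<^sub>C u"
    using A B by (simp add: P_def outer_apply pos_ops_cinner)
  finally show ?thesis .
qed

text \<open>Compression to a line decreases I and bI, so by \<open>mean_eigenvector\<close> every
  unit vector is an eigenvector. An operator with this property is scalar.\<close>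

lemma mean_scalar:
  assumes "0 \<le> b"
  shows "\<exists>c. \<sigma> id_blinfun (b *\<^sub>R id_blinfun) = c *\<^sub>R id_blinfun"
proof -
  define S where "S = \<sigma> id_blinfun (b *\<^sub>R id_blinfun)"
  have S: "S \<in> pos_ops" using assms by (simp add: S_def)
  have unit: "S u = complex_of_real (qform S u) *\<^sub>C u" if "norm u = 1" for u
    unfolding S_def using assms that cmod_cinner_unit_le[OF that]
    by (intro mean_eigenvector) (auto simp: qform_scaleR outer_apply norm_scaleC intro!: mult_left_mono)
  have eig: "\<exists>m. S y = m *\<^sub>C y" for y
  proof (cases "y = 0")
    case False
    define u where "u = (1 / norm y) *\<^sub>R y"
    have "norm u = 1" and y: "y = complex_of_real (norm y) *\<^sub>C u"
      using False by (simp_all add: u_def flip: scaleR_eq_scaleC)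
    have "S y = complex_of_real (qform S u) *\<^sub>C y"
      using unit[OF \<open>norm u = 1\<close>]
      by (subst (1 2) y) (simp add: bounded_opsD[OF pos_ops_bounded[OF S]] scaleC_scaleC mult.commute)
    thus ?thesis by blast
  qed (simp add: exI[of _ 0])
  obtain e :: 'a where e: "norm e = 1" by (rule unit_vector)
  define c where "c = qform S e"
  \<comment> \<open>Symmetry of S, tested against the fixed eigenvector e, forces the eigenvalue of
    y to be c. A vector orthogonal to e is treated through e + y.\<close>
  have nonorth: "S y = c *\<^sub>R y" if "cinner e y \<noteq> 0" for y
  proof -
    from eig[of y] obtain m where m: "S y = m *\<^sub>C y" by blast
    have "m * cinner e y = cinner (S e) y"
      by (simp add: m cinner_scaleC_right pos_ops_hermitian[OF S, symmetric])
    also have "\<dots> = of_real c * cinner e y"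
      by (simp add: unit[OF e] c_def cinner_scaleC_left)
    finally show ?thesis using that m by (simp add: scaleR_eq_scaleC)
  qed
  have "S y = c *\<^sub>R y" for y
  proof (cases "cinner e y = 0")
    case True
    have "S (e + y) = c *\<^sub>R (e + y)"
      by (rule nonorth) (simp add: cinner_add_right True cinner_self e)
    moreover have "S e = c *\<^sub>R e" by (simp add: unit[OF e] c_def scaleR_eq_scaleC)
    ultimately show ?thesis by (simp add: blinfun.add_right scaleR_add_right)
  qed (rule nonorth)
  hence "S = c *\<^sub>R id_blinfun" by (intro blinfun_eqI) (simp add: blinfun.scaleR_left)
  thus ?thesis unfolding S_def by blast
qed

text \<open>The representing function \<open>f\<^sub>\<sigma>\<close> of \<open>\<sigma>\<close>; its values at negative arguments are junk.\<close>

definition repr :: "real \<Rightarrow> real" where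
  "repr b = (SOME c. \<sigma> id_blinfun (b *\<^sub>R id_blinfun) = c *\<^sub>R id_blinfun)"

lemma mean_id_scalar: "0 \<le> b \<Longrightarrow> \<sigma> id_blinfun (b *\<^sub>R id_blinfun) = repr b *\<^sub>R id_blinfun"
  unfolding repr_def using mean_scalar by (rule someI_ex)

lemma repr_one: "repr 1 = 1"
proof -
  obtain e :: 'a where "norm e = 1" by (rule unit_vector)
  thus ?thesis
    using arg_cong[OF mean_id_scalar[of 1], of "\<lambda>T. qform T e"] by (simp add: mean_id qform_scaleR)
qed

lemma repr_nonneg: "0 \<le> b \<Longrightarrow> 0 \<le> repr b"
proof -
  assume b: "0 \<le> b"
  obtain e :: 'a where e: "norm e = 1" by (rule unit_vector)
  have "0 \<le> qform (\<sigma> id_blinfun (b *\<^sub>R id_blinfun)) e"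
    using b by (intro qform_nonneg) simp
  thus ?thesis using b e by (simp add: mean_id_scalar qform_scaleR)
qed

lemma repr_mono:
  assumes "0 \<le> a" "a \<le> b"
  shows "repr a \<le> repr b"
proof -
  obtain e :: 'a where e: "norm e = 1" by (rule unit_vector)
  have "qform (\<sigma> id_blinfun (a *\<^sub>R id_blinfun)) e \<le> qform (\<sigma> id_blinfun (b *\<^sub>R id_blinfun)) e"
    using assms by (intro mean_mono) (auto simp: qform_scaleR mult_right_mono)
  thus ?thesis using assms e by (simp add: mean_id_scalar qform_scaleR)
qed

text \<open>Compress by the projection P onto the line of u: it fixes u, and P A P is the multiple
  \<open>qform A u\<close> of P, hence below aI; likewise for B.\<close>

lemma qform_mean_unit_le:
  assumes A: "A \<in> pos_ops" and B: "B \<in> pos_ops" and u: "norm u = 1"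
    and a: "qform A u \<le> a" and b: "qform B u \<le> b"
  shows "qform (\<sigma> A B) u \<le> qform (\<sigma> (a *\<^sub>R id_blinfun) (b *\<^sub>R id_blinfun)) u"
proof -
  have le: "qform T (outer u u y) \<le> c * (norm y)\<^sup>2" if "T \<in> pos_ops" "qform T u \<le> c" for T c y
  proof -
    have "qform T (outer u u y) = (cmod (cinner u y))\<^sup>2 * qform T u"
      by (simp add: outer_apply qform_scaleC_vec[OF that(1)])
    also have "\<dots> \<le> (norm y)\<^sup>2 * c"
      by (intro mult_mono cmod_cinner_unit_le u that) (auto simp: qform_nonneg that)
    finally show ?thesis by (simp add: mult.commute)
  qed
  have "0 \<le> a" "0 \<le> b"
    using qform_nonneg[OF A, of u] qform_nonneg[OF B, of u] a b by linarith+
  have "qform (\<sigma> A B) u = qform (\<sigma> A B) (outer u u u)"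
    by (simp add: outer_unit_apply u)
  also have "\<dots> \<le> qform (\<sigma> (outer u u o\<^sub>L A o\<^sub>L outer u u) (outer u u o\<^sub>L B o\<^sub>L outer u u)) u"
    by (intro mean_transformer A B) simp
  also have "\<dots> \<le> qform (\<sigma> (a *\<^sub>R id_blinfun) (b *\<^sub>R id_blinfun)) u"
    using A B a b \<open>0 \<le> a\<close> \<open>0 \<le> b\<close>
    by (intro mean_mono) (auto simp: qform_sandwich qform_scaleR intro!: le)
  finally show ?thesis .
qed

lemma mean_multiple_le:
  assumes Y: "Y \<in> pos_ops" and b: "0 \<le> b"
  shows "qform (\<sigma> Y (b *\<^sub>R Y)) x \<le> repr b * qform Y x"
proof (cases "x = 0")
  case False
  define u where "u = (1 / norm x) *\<^sub>R x"
  have u: "norm u = 1" and x: "x = norm x *\<^sub>R u" using False by (simp_all add: u_def)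
  define c where "c = qform Y u"
  have c: "0 \<le> c" by (simp add: c_def qform_nonneg[OF Y])
  have "qform (\<sigma> Y (b *\<^sub>R Y)) u \<le> repr b * c + e" if "e > 0" for e
  proof -
    \<comment> \<open>The slack d > 0 is needed because c may vanish while
      \<open>mean_scaleR\<close> requires a positive factor.\<close>
    define d where "d = e / (repr b + 1)"
    have rb: "repr b \<ge> 0" by (rule repr_nonneg[OF b])
    have d: "d > 0" "repr b * d \<le> e" using that rb by (auto simp: d_def field_simps)
    have "qform (\<sigma> Y (b *\<^sub>R Y)) u \<le> qform (\<sigma> ((c + d) *\<^sub>R id_blinfun) (((c + d) * b) *\<^sub>R id_blinfun)) u"
      using Y b d by (intro qform_mean_unit_le u) (auto simp: c_def qform_scaleR algebra_simps)
    also have "\<sigma> ((c + d) *\<^sub>R id_blinfun) (((c + d) * b) *\<^sub>R id_blinfun)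
        = (c + d) *\<^sub>R \<sigma> id_blinfun (b *\<^sub>R id_blinfun)"
      using mean_scaleR[of id_blinfun "b *\<^sub>R id_blinfun" "c + d"] b c d by simp
    also have "qform \<dots> u = (c + d) * repr b"
      by (simp add: mean_id_scalar[OF b] qform_scaleR u)
    also have "\<dots> \<le> repr b * c + e" using d by (simp add: algebra_simps)
    finally show ?thesis .
  qed
  hence "qform (\<sigma> Y (b *\<^sub>R Y)) u \<le> repr b * c" by (rule field_le_epsilon)
  hence "(norm x)\<^sup>2 * qform (\<sigma> Y (b *\<^sub>R Y)) u \<le> (norm x)\<^sup>2 * (repr b * c)"
    by (rule mult_left_mono) simp
  moreover have "qform T x = (norm x)\<^sup>2 * qform T u" if "T \<in> pos_ops" for T
    using qform_scaleR_vec[OF that, of "norm x" u] x by simp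
  ultimately show ?thesis using Y b by (simp add: c_def algebra_simps)
qed simp

text \<open>The operator C is the explicit square root of \<open>outer r r\<close>; axiom (II) with
  this C transports the mean of I and bI to rank-one operators.\<close>

lemma mean_rank_one_ge:
  assumes b: "0 \<le> b"
  shows "repr b * (cmod (cinner r y))\<^sup>2 \<le> qform (\<sigma> (outer r r) (b *\<^sub>R outer r r)) y"
proof (cases "r = 0")
  case True
  thus ?thesis using b by (simp add: qform_nonneg)
next
  case False
  define C where "C = (1 / norm r) *\<^sub>R outer r r"
  have C: "C \<in> pos_ops" by (simp add: C_def)
  have CC: "C o\<^sub>L id_blinfun o\<^sub>L C = outer r r"
    using False
    by (intro blinfun_eqI) (simp add: C_def blinfun.scaleR_left blinfun.scaleR_right outer_apply
        cinner_scaleC_right cinner_self scaleR_eq_scaleC scaleC_scaleC power2_eq_square)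
  have "norm (C y) = cmod (cinner r y)"
    using False by (simp add: C_def blinfun.scaleR_left outer_apply norm_scaleC)
  hence "repr b * (cmod (cinner r y))\<^sup>2 = qform (\<sigma> id_blinfun (b *\<^sub>R id_blinfun)) (C y)"
    by (simp add: mean_id_scalar[OF b] qform_scaleR)
  also have "\<dots> \<le> qform (\<sigma> (C o\<^sub>L id_blinfun o\<^sub>L C) (C o\<^sub>L (b *\<^sub>R id_blinfun) o\<^sub>L C)) y"
    using b by (intro mean_transformer C) auto
  also have "C o\<^sub>L (b *\<^sub>R id_blinfun) o\<^sub>L C = b *\<^sub>R outer r r"
    unfolding CC[symmetric] by (intro blinfun_eqI) (simp add: blinfun.scaleR_left blinfun.scaleR_right)
  finally show ?thesis by (simp add: CC)
qed

lemma mean_multiple_ge: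
  assumes Y: "Y \<in> pos_ops" and b: "0 \<le> b"
  shows "repr b * qform Y x \<le> qform (\<sigma> Y (b *\<^sub>R Y)) x"
proof -
  obtain r where r: "\<And>y. (cmod (cinner r y))\<^sup>2 \<le> qform Y y" "(cmod (cinner r x))\<^sup>2 = qform Y x"
    using rank_one_minorant[OF Y] by metis
  have "repr b * qform Y x \<le> qform (\<sigma> (outer r r) (b *\<^sub>R outer r r)) x"
    using mean_rank_one_ge[OF b, of r x] r by simp
  also have "\<dots> \<le> qform (\<sigma> Y (b *\<^sub>R Y)) x"
    using Y b r by (intro mean_mono) (auto simp: qform_outer qform_scaleR mult_left_mono)
  finally show ?thesis .
qed

end

lemma qform_dominated:
  assumes "e > 0" "\<And>x. e * (norm x)\<^sup>2 \<le> qform T x"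
  shows "qform S x \<le> (norm S + 1) / e * qform T x"
proof -
  have "qform S x \<le> (norm S + 1) * (norm x)\<^sup>2"
    using qform_le_norm[of S x] zero_le_power2[of "norm x"] unfolding distrib_right by linarith
  also have "\<dots> \<le> (norm S + 1) * (qform T x / e)"
    using assms(2)[of x] \<open>e > 0\<close> by (intro mult_left_mono) (auto simp: field_simps)
  finally show ?thesis by simp
qed

lemma pos_inv_ops_dominates:
  assumes "T \<in> pos_inv_ops"
  obtains l where "l > 0" "\<And>x. qform S x \<le> l * qform T x"
proof -
  obtain e where e: "e > 0" "\<And>x. e * (norm x)\<^sup>2 \<le> qform T x"
    using pos_inv_ops_bounded_below[OF assms] by metis
  have "(norm S + 1) / e > 0" using e(1) by (simp add: add_nonneg_pos)
  thus ?thesis using that qform_dominated[OF e] by blast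
qed

section \<open>A nontrivial mean has a representing function that is not eventually constant\<close>

context kubo_ando_mean
begin

text \<open>
  Here \<open>B\<close> is diagonal with entries \<open>K + 1\<close> and \<open>c\<close> in a basis tilted so slightly against
  \<open>x\<close> that still \<open>K x x\<^sup>* \<le> B\<close>; comparing the means with the identity at \<open>x\<close> gives
  \<open>f(K) \<le> (1 - p) f(K + 1) + p f(c)\<close> for the representing function \<open>f\<close>.
\<close>

lemma repr_flat:
  assumes "K > 0" and flat: "repr (K + 1) = repr K" and "c > 0"
  shows "repr K \<le> repr c"
proof (cases "c < K")
  case False
  thus ?thesis using \<open>K > 0\<close> by (intro repr_mono) auto
next
  case True
  obtain z :: "nat \<Rightarrow> 'a" where z: "\<And>n. norm (z n) = 1" "\<And>m n. m \<noteq> n \<Longrightarrow> cinner (z m) (z n) = 0"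
    using orthonormal_sequence[OF inf_dim] by metis
  define u v where "u = z 0" and "v = z 1"
  have uv: "norm u = 1" "norm v = 1" "cinner u v = 0" "cinner v u = 0"
    by (simp_all add: u_def v_def z)
  have bessel: "(cmod (cinner u y))\<^sup>2 + (cmod (cinner v y))\<^sup>2 \<le> (norm y)\<^sup>2" for y
    using Bessel_inequality[of z y 2, OF z] by (simp add: u_def v_def numeral_2_eq_2)
  \<comment> \<open>The second entry gives K (K + 1) p \<le> c, which bounds the constant in the
    weighted Cauchy-Schwarz estimate below; the entry 1/2 keeps p < 1.\<close>
  define p where "p = min (1/2) (c / (K * (K + 1)))"
  have KK: "K * (K + 1) > 0" using \<open>K > 0\<close> by simp
  have p: "0 < p" "p < 1" using KK \<open>c > 0\<close> by (auto simp: p_def min_less_iff_disj)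
  have "K * (K + 1) * p \<le> K * (K + 1) * (c / (K * (K + 1)))"
    using KK by (intro mult_left_mono) (auto simp: p_def)
  hence p_le: "K * (K + 1) * p \<le> c" using \<open>K > 0\<close> by simp
  define C S where "C = sqrt (1 - p)" and "S = sqrt p"
  have CS: "C\<^sup>2 = 1 - p" "S\<^sup>2 = p" "0 \<le> C" "0 \<le> S" using p by (auto simp: C_def S_def)
  define x where "x = C *\<^sub>R v + S *\<^sub>R u"
  have "cinner x x = of_real (C\<^sup>2 + S\<^sup>2)"
    unfolding x_def cinner_add_left cinner_add_right cinner_scaleR_left cinner_scaleR_right
    by (simp add: uv cinner_self power2_eq_square)
  hence x: "cinner x x = 1" "norm x = 1" using CS cmod_cinner_self[of x] norm_ge_zero[of x] by (auto simp: power2_eq_1_iff simp del: norm_ge_zero)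
  define B where "B = (K + 1) *\<^sub>R (id_blinfun - outer u u) + c *\<^sub>R outer u u"
  have B: "B \<in> pos_ops" using uv \<open>K > 0\<close> \<open>c > 0\<close> by (simp add: B_def)
  have qB: "qform B y = (K + 1) * ((norm y)\<^sup>2 - (cmod (cinner u y))\<^sup>2) + c * (cmod (cinner u y))\<^sup>2" for y
    by (simp add: B_def qform_add qform_scaleR qform_diff qform_outer)
  define T where "T = \<sigma> id_blinfun B"
  have T: "T \<in> pos_ops" using B by (simp add: T_def)
  have "qform (K *\<^sub>R outer x x) y \<le> qform B y" for y
  proof -
    define \<alpha> \<beta> where "\<alpha> = cmod (cinner v y)" and "\<beta> = cmod (cinner u y)"
    have "cmod (cinner x y) \<le> C * \<alpha> + S * \<beta>"
      unfolding x_def cinner_add_left cinner_scaleR_left \<alpha>_def \<beta>_def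
      by (rule order.trans[OF norm_triangle_ineq]) (use CS in \<open>simp add: norm_mult\<close>)
    hence "(cmod (cinner x y))\<^sup>2 \<le> (C * \<alpha> + S * \<beta>)\<^sup>2" by (intro power_mono) auto
    hence "K * (cmod (cinner x y))\<^sup>2 \<le> K * (C * \<alpha> + S * \<beta>)\<^sup>2" using \<open>K > 0\<close> by simp
    also have "\<dots> \<le> (K + 1) * \<alpha>\<^sup>2 + c * \<beta>\<^sup>2"
    proof -
      \<comment> \<open>Cauchy-Schwarz with weights K + 1 and c, cleared of denominators: this
        square is the exact defect.\<close>
      have "0 \<le> K * (C * c * \<beta> - S * (K + 1) * \<alpha>)\<^sup>2" using \<open>K > 0\<close> by simp
      also have "\<dots> = K * (C\<^sup>2 * c + S\<^sup>2 * (K + 1)) * ((K + 1) * \<alpha>\<^sup>2 + c * \<beta>\<^sup>2)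
          - (K + 1) * c * (K * (C * \<alpha> + S * \<beta>)\<^sup>2)"
        by (simp add: power2_eq_square algebra_simps)
      finally have "(K + 1) * c * (K * (C * \<alpha> + S * \<beta>)\<^sup>2)
          \<le> K * (C\<^sup>2 * c + S\<^sup>2 * (K + 1)) * ((K + 1) * \<alpha>\<^sup>2 + c * \<beta>\<^sup>2)" by simp
      also have "\<dots> \<le> ((K + 1) * c) * ((K + 1) * \<alpha>\<^sup>2 + c * \<beta>\<^sup>2)"
      proof (rule mult_right_mono)
        have "0 \<le> K * p * c" using \<open>K > 0\<close> \<open>c > 0\<close> p by simp
        thus "K * (C\<^sup>2 * c + S\<^sup>2 * (K + 1)) \<le> (K + 1) * c"
          unfolding CS using p_le by (simp add: algebra_simps)
      qed (use \<open>K > 0\<close> \<open>c > 0\<close> in auto)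
      finally show ?thesis
        by (rule mult_left_le_imp_le) (use \<open>K > 0\<close> \<open>c > 0\<close> in auto)
    qed
    also have "\<dots> \<le> qform B y"
    proof -
      have "(K + 1) * \<alpha>\<^sup>2 \<le> (K + 1) * ((norm y)\<^sup>2 - \<beta>\<^sup>2)"
        using bessel[of y] \<open>K > 0\<close> by (intro mult_left_mono) (auto simp: \<alpha>_def \<beta>_def)
      thus ?thesis by (simp add: qB \<beta>_def)
    qed
    finally show ?thesis by (simp add: qform_scaleR qform_outer)
  qed
  hence "qform (\<sigma> (outer x x) (K *\<^sub>R outer x x)) x \<le> qform T x"
    unfolding T_def using B \<open>K > 0\<close> cmod_cinner_unit_le[OF x(2)]
    by (intro mean_mono) (auto simp: qform_outer)
  hence 1: "repr K \<le> qform T x"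
    using mean_rank_one_ge[of K x x] \<open>K > 0\<close> by (simp add: x)
  have Tu: "T u = complex_of_real (qform T u) *\<^sub>C u"
    unfolding T_def
  proof (rule mean_eigenvector)
    show "qform id_blinfun (outer u u y) \<le> qform id_blinfun y" for y
      using cmod_cinner_unit_le[OF uv(1), of y] by (simp add: outer_apply norm_scaleC uv)
    show "qform B (outer u u y) \<le> qform B y" for y
    proof -
      have "0 \<le> (K + 1) * ((norm y)\<^sup>2 - (cmod (cinner u y))\<^sup>2)"
        using cmod_cinner_unit_le[OF uv(1), of y] \<open>K > 0\<close> by simp
      thus ?thesis
        by (simp add: qB outer_apply norm_scaleC uv cinner_scaleC_right cinner_self norm_mult)
    qed
  qed (use B uv in auto)
  \<comment> \<open>As u is an eigenvector of T and v is orthogonal to it, the cross term vanishes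
    and the form at x is a convex combination of those at v and u.\<close>
  have "cinner (C *\<^sub>R v) (T (S *\<^sub>R u)) = 0"
    by (simp add: blinfun.scaleR_right Tu cinner_scaleR_left cinner_scaleR_right cinner_scaleC_right uv)
  hence 2: "qform T x = (1 - p) * qform T v + p * qform T u"
    unfolding x_def qform_add_vec[OF T] by (simp add: qform_scaleR_vec[OF T] CS)
  have v_le: "qform T v \<le> repr (K + 1)"
    using qform_mean_unit_le[of id_blinfun B v 1 "K + 1"] B uv \<open>K > 0\<close>
    by (simp add: T_def qB mean_id_scalar qform_scaleR)
  have u_le: "qform T u \<le> repr c"
    using qform_mean_unit_le[of id_blinfun B u 1 c] B uv \<open>c > 0\<close>
    by (simp add: T_def qB mean_id_scalar qform_scaleR cinner_self)
  have "(1 - p) * qform T v + p * qform T u \<le> (1 - p) * repr K + p * repr c"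
    using v_le u_le p flat by (intro add_mono mult_left_mono) auto
  hence "p * repr K \<le> p * repr c" using 1 2 by (simp add: algebra_simps)
  thus ?thesis using p by simp
qed

text \<open>If f is constant beyond K, then \<open>repr_flat\<close> spreads the constant to all b >
  0, and f(1) = 1 identifies it. For Y and B bounded below, kY \<le> B \<le> lY then squeezes
  \<open>\<sigma> Y B\<close> to Y; axiom (III) extends this to all positive pairs.\<close>

lemma repr_strict:
  assumes "\<not> means_equal \<sigma> left_trivial_mean" "0 \<le> K"
  shows "\<exists>b\<ge>K. repr K < repr b"
proof (rule ccontr)
  assume "\<not> ?thesis"
  hence *: "repr b \<le> repr K" if "b \<ge> K" for b using that by force
  have flat: "repr b = repr K" if "b \<ge> K" for b
    using *[OF that] repr_mono[OF \<open>0 \<le> K\<close> that] by simp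
  \<comment> \<open>The point K + 1 replaces K since \<open>repr_flat\<close> needs a positive
    argument.\<close>
  have ge: "repr K \<le> repr b" if "b > 0" for b
    using repr_flat[of "K + 1" b] flat[of "K + 1"] flat[of "K + 1 + 1"] that \<open>0 \<le> K\<close> by simp
  have "repr b = repr K" if "b > 0" for b
    using ge[OF that] flat[of b] repr_mono[of b K] that by (cases "b \<ge> K") auto
  hence one: "repr b = 1" if "b > 0" for b
    using that repr_one by (metis zero_less_one)
  have eq: "\<sigma> Y B = Y"
    if "Y \<in> pos_ops" "B \<in> pos_ops" "e > 0" "\<And>x. e * (norm x)\<^sup>2 \<le> qform Y x" "\<And>x. e * (norm x)\<^sup>2 \<le> qform B x"
    for Y B e
  proof -
    define k l where "k = e / (norm Y + 1)" and "l = (norm B + 1) / e"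
    have kl: "k > 0" "l > 0" using \<open>e > 0\<close> by (auto simp: k_def l_def add_nonneg_pos intro!: divide_pos_pos)
    have low: "k * qform Y x \<le> qform B x" for x
    proof -
      have "(norm Y + 1) / e = 1 / k" by (simp add: k_def)
      hence "qform Y x \<le> 1 / k * qform B x" using qform_dominated[OF that(3,5), of Y x] by simp
      thus ?thesis using kl by (simp add: field_simps)
    qed
    have up: "qform B x \<le> l * qform Y x" for x
      using qform_dominated[OF that(3,4), of B x] by (simp add: l_def)
    have "qform Y x \<le> qform (\<sigma> Y B) x" for x
    proof -
      have "qform Y x \<le> qform (\<sigma> Y (k *\<^sub>R Y)) x"
        using mean_multiple_ge[OF that(1), of k x] kl by (simp add: one)
      also have "\<dots> \<le> qform (\<sigma> Y B) x"
        using that kl low by (intro mean_mono) (auto simp: qform_scaleR)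
      finally show ?thesis .
    qed
    moreover have "qform (\<sigma> Y B) x \<le> qform Y x" for x
    proof -
      have "qform (\<sigma> Y B) x \<le> qform (\<sigma> Y (l *\<^sub>R Y)) x"
        using that kl up by (intro mean_mono) (auto simp: qform_scaleR)
      also have "\<dots> \<le> qform Y x"
        using mean_multiple_le[OF that(1), of l x] kl by (simp add: one)
      finally show ?thesis .
    qed
    ultimately show ?thesis using that by (intro op_le_antisym) (auto simp: op_le_iff)
  qed
  have "\<sigma> Y B = Y" if Y: "Y \<in> pos_ops" and B: "B \<in> pos_ops" for Y B
  proof -
    \<comment> \<open>Shifting both arguments by I/(n + 1) makes them bounded below.\<close>
    define d where "d n = inverse (real (Suc n))" for n
    have d: "d n > 0" "d (Suc n) \<le> d n" for n by (auto simp: d_def field_simps)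
    have "d \<longlonglongrightarrow> 0" unfolding d_def by (rule LIMSEQ_inverse_real_of_nat)
    define T where "T n = d n *\<^sub>R (id_blinfun :: 'a operator)" for n
    have "T \<searrow> 0"
      unfolding sot_decreasing_to_def
    proof (intro conjI allI)
      show "T (Suc n) \<preceq> T n" for n
        using d[of n] d[of "Suc n"] by (simp add: T_def op_le_iff qform_scaleR mult_right_mono)
      show "(\<lambda>n. T n x) \<longlonglongrightarrow> blinfun_apply 0 x" for x
        using tendsto_scaleR[OF \<open>d \<longlonglongrightarrow> 0\<close> tendsto_const, of x] by (simp add: T_def blinfun.scaleR_left)
    qed
    hence lim: "(\<lambda>n. S + T n) \<searrow> S" for S
      using sot_decreasing_scale_add[of T 0 1 S] by simp
    have T: "T n \<in> pos_ops" for n using d[of n] by (simp add: T_def)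
    have "\<sigma> (Y + T n) (B + T n) = Y + T n" for n
      using Y B T d[of n] qform_nonneg[OF Y] qform_nonneg[OF B]
      by (intro eq[of _ _ "d n"]) (auto simp: qform_add T_def qform_scaleR)
    hence "(\<lambda>n. Y + T n) \<searrow> \<sigma> Y B"
      using mean_decreasing[OF _ _ Y B lim lim] Y B T by simp
    thus ?thesis
      using lim[of Y] unfolding sot_decreasing_to_def
      by (intro blinfun_eqI) (blast intro: LIMSEQ_unique)
  qed
  hence "means_equal \<sigma> left_trivial_mean" by (simp add: means_equal_def left_trivial_mean_def)
  thus False using assms by simp
qed

section \<open>Strict monotonicity\<close>

text \<open>The line of z is cut out by E and reused as a free direct summand. On it the scalars 1
  and b have mean f(b); conjugation by C folds this summand back onto s = E r, where it becomes the
  added rank-one terms.\<close>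

lemma mean_add_rank_one_compressed:
  assumes Y: "Y \<in> pos_ops" and A: "A \<in> pos_ops" and b: "0 \<le> b" and z: "norm z = 1"
  defines "E \<equiv> id_blinfun - outer z z"
  shows "qform (\<sigma> Y A) (E x) + repr b * (cmod (cinner (E r) x))\<^sup>2
    \<le> qform (\<sigma> (E o\<^sub>L (Y + outer r r) o\<^sub>L E) (E o\<^sub>L (A + b *\<^sub>R outer r r) o\<^sub>L E)) x"
proof -
  define s where "s = E r"
  have E: "E \<in> pos_ops" using z by (simp add: E_def)
  have E_apply: "E y = y - cinner z y *\<^sub>C z" for y
    by (simp add: E_def blinfun.diff_left outer_apply)
  have zE: "cinner z (E y) = 0" for y
    by (simp add: E_apply cinner_diff_right cinner_scaleC_right cinner_self z)
  hence Ez: "cinner (E y) z = 0" for y using cinner_commute[of "E y" z] by simp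
  have EE: "E (E y) = E y" for y by (simp add: E_apply[of "E y"] zE)
  have E_z: "E z = 0" by (simp add: E_apply cinner_self z scaleC_one)
  have sz: "cinner z s = 0" "cinner s z = 0" "E s = s" by (simp_all add: s_def zE Ez EE)
  have sE: "cinner s (E y) = cinner s y" for y
    using pos_ops_hermitian[OF E, of s y] sz by simp
  define P where "P = outer z z"
  have P: "P \<in> pos_ops" by (simp add: P_def)
  text \<open>\<open>C\<close> equals \<open>G G\<^sup>*\<close> for \<open>G = E + s z\<^sup>*\<close>, hence is positive, and \<open>C E\<close> sends \<open>x\<close> to
    \<open>E x + \<langle>s, x\<rangle> z\<close>.\<close>
  define C where "C = E + outer s z + outer z s + (norm s)\<^sup>2 *\<^sub>R P"
  have C_apply: "C y = E y + cinner z y *\<^sub>C s + cinner s y *\<^sub>C z + (complex_of_real ((norm s)\<^sup>2) * cinner z y) *\<^sub>C z" for y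
    by (simp add: C_def blinfun.add_left blinfun.scaleR_left outer_apply P_def scaleR_eq_scaleC scaleC_scaleC)
  have C: "C \<in> pos_ops"
  proof (rule pos_opsI[where h = "\<lambda>y. (norm (E y + cinner z y *\<^sub>C s))\<^sup>2"])
    show "C \<in> bounded_ops" using E P by (simp add: C_def pos_ops_bounded)
    fix y
    have "cinner (E y) (E y) = cinner y (E y)"
      using pos_ops_hermitian[OF E, of y "E y"] by (simp add: EE)
    moreover have "cinner (E y) s = cinner y s"
      using pos_ops_hermitian[OF E, of y s] by (simp add: sz)
    moreover have "cinner y z = cnj (cinner z y)" by (rule cinner_commute)
    ultimately show "cinner y (C y) = complex_of_real ((norm (E y + cinner z y *\<^sub>C s))\<^sup>2)"
      unfolding cinner_self[symmetric]
      by (simp add: C_apply cinner_add_left cinner_add_right cinner_scaleC_left cinner_scaleC_right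
          sE cinner_self[of s] algebra_simps del: of_real_power)
  qed simp
  have CE: "C (E y) = E y + cinner s y *\<^sub>C z" for y
    by (simp add: C_apply zE EE sE)
  have lift: "qform (C o\<^sub>L ((E o\<^sub>L W o\<^sub>L E) + c *\<^sub>R P) o\<^sub>L C) (E y)
      = qform (E o\<^sub>L (W + c *\<^sub>R outer r r) o\<^sub>L E) y" for W c y
  proof -
    have "qform P (E y + cinner s y *\<^sub>C z) = (cmod (cinner s y))\<^sup>2"
      by (simp add: P_def qform_outer cinner_add_right cinner_scaleC_right zE cinner_self z)
    moreover have "E (E y + cinner s y *\<^sub>C z) = E y"
      by (simp add: blinfun.add_right EE bounded_opsD[OF pos_ops_bounded[OF E]] E_z)
    moreover have "cinner r (E y) = cinner s y"
      using pos_ops_hermitian[OF E, of r y] by (simp add: s_def)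
    ultimately show ?thesis
      by (simp add: qform_sandwich[OF C] qform_sandwich[OF E] CE qform_add qform_scaleR qform_outer)
  qed
  \<comment> \<open>Direct sums: the compressions of Y and A on the range of E, and the scalars 1
    and b on the line of z.\<close>
  define \<Phi> where "\<Phi> = (E o\<^sub>L Y o\<^sub>L E) + P"
  define \<Psi> where "\<Psi> = (E o\<^sub>L A o\<^sub>L E) + b *\<^sub>R P"
  have \<Phi>: "\<Phi> \<in> pos_ops" and \<Psi>: "\<Psi> \<in> pos_ops"
    using Y A E P b by (simp_all add: \<Phi>_def \<Psi>_def)
  define T where "T = \<sigma> \<Phi> \<Psi>"
  have T: "T \<in> pos_ops" using \<Phi> \<Psi> by (simp add: T_def)
  have qP: "qform P (P y) = qform P y" for y
    by (simp add: P_def qform_outer outer_apply cinner_scaleC_right cinner_self z norm_mult)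
  have EP: "E (P y) = 0" for y
    by (simp add: P_def outer_apply bounded_opsD[OF pos_ops_bounded[OF E]] E_z)
  have Tz: "T z = complex_of_real (qform T z) *\<^sub>C z"
    unfolding T_def
  proof (rule mean_eigenvector[OF \<Phi> \<Psi> z])
    show "qform \<Phi> (outer z z y) \<le> qform \<Phi> y" for y
      using qP[of y] EP[of y] qform_nonneg[OF Y, of "E y"]
      by (simp add: \<Phi>_def qform_add qform_sandwich[OF E] P_def)
    show "qform \<Psi> (outer z z y) \<le> qform \<Psi> y" for y
      using qP[of y] EP[of y] qform_nonneg[OF A, of "E y"]
      by (simp add: \<Psi>_def qform_add qform_scaleR qform_sandwich[OF E] P_def)
  qed
  have "repr b \<le> qform (\<sigma> P (b *\<^sub>R P)) z"
    using mean_rank_one_ge[OF b, of z z] by (simp add: P_def cinner_self z)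
  also have "\<dots> \<le> qform T z"
    unfolding T_def using \<Phi> \<Psi> P b qform_nonneg[OF Y] qform_nonneg[OF A]
    by (intro mean_mono) (auto simp: \<Phi>_def \<Psi>_def qform_add qform_sandwich[OF E])
  finally have T_z: "repr b \<le> qform T z" .
  have "qform (\<sigma> Y A) (E x) = qform (\<sigma> Y A) (E (E x))" by (simp add: EE)
  also have "\<dots> \<le> qform (\<sigma> (E o\<^sub>L Y o\<^sub>L E) (E o\<^sub>L A o\<^sub>L E)) (E x)"
    by (intro mean_transformer Y A E)
  also have "\<dots> \<le> qform T (E x)"
    unfolding T_def using Y A E P b \<Phi> \<Psi> qform_nonneg[OF P]
    by (intro mean_mono) (auto simp: \<Phi>_def \<Psi>_def qform_add qform_scaleR)
  finally have T_E: "qform (\<sigma> Y A) (E x) \<le> qform T (E x)" .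
  \<comment> \<open>Since z is an eigenvector of T, the contributions of the two summands simply add
    up.\<close>
  have "cinner (E x) (T (cinner s x *\<^sub>C z)) = 0"
    by (simp add: bounded_opsD[OF pos_ops_bounded[OF T]] Tz cinner_scaleC_right Ez)
  hence "qform T (C (E x)) = qform T (E x) + (cmod (cinner s x))\<^sup>2 * qform T z"
    unfolding CE qform_add_vec[OF T] by (simp add: qform_scaleC_vec[OF T])
  moreover have "(cmod (cinner s x))\<^sup>2 * repr b \<le> (cmod (cinner s x))\<^sup>2 * qform T z"
    using T_z by (intro mult_left_mono) auto
  ultimately have "qform (\<sigma> Y A) (E x) + repr b * (cmod (cinner s x))\<^sup>2 \<le> qform T (C (E x))"
    using T_E by (simp add: mult.commute)
  also have "\<dots> \<le> qform (\<sigma> (C o\<^sub>L \<Phi> o\<^sub>L C) (C o\<^sub>L \<Psi> o\<^sub>L C)) (E x)"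
    unfolding T_def by (intro mean_transformer \<Phi> \<Psi> C)
  \<comment> \<open>Axiom (II) with E restricts the conjugates by C to the range of E, where
    \<open>lift\<close> identifies their forms with those of the compressed sums.\<close>
  also have "\<dots> \<le> qform (\<sigma> (E o\<^sub>L (C o\<^sub>L \<Phi> o\<^sub>L C) o\<^sub>L E) (E o\<^sub>L (C o\<^sub>L \<Psi> o\<^sub>L C) o\<^sub>L E)) x"
    using \<Phi> \<Psi> C E by (intro mean_transformer) auto
  also have "\<dots> \<le> qform (\<sigma> (E o\<^sub>L (Y + outer r r) o\<^sub>L E) (E o\<^sub>L (A + b *\<^sub>R outer r r) o\<^sub>L E)) x"
    using Y A b \<Phi> \<Psi> C E lift[of Y 1] lift[of A b]
    by (intro mean_mono) (simp_all add: qform_sandwich[OF E, of "C o\<^sub>L _ o\<^sub>L C"] \<Phi>_def \<Psi>_def)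
  finally show ?thesis by (simp add: s_def)
qed

text \<open>
  The extra dimension that the usual proof of superadditivity needs is supplied by a vector \<open>z n\<close> that escapes to infinity along an orthonormal sequence;
  the error of cutting it out is absorbed by continuity from above.
\<close>

lemma mean_add_rank_one:
  assumes Y: "Y \<in> pos_ops" and A: "A \<in> pos_ops" and b: "0 \<le> b" and \<eta>: "\<eta> > 0"
  shows "qform (\<sigma> Y A) x + repr b * (cmod (cinner r x))\<^sup>2
    \<le> qform (\<sigma> ((1 + \<eta>) *\<^sub>R (Y + outer r r)) ((1 + \<eta>) *\<^sub>R (A + b *\<^sub>R outer r r))) x"
proof -
  obtain z :: "nat \<Rightarrow> 'a" where z: "\<And>n. norm (z n) = 1" "\<And>m n. m \<noteq> n \<Longrightarrow> cinner (z m) (z n) = 0"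
    using orthonormal_sequence[OF inf_dim] by metis
  obtain Q where Q: "\<And>n. Q n \<in> pos_ops" "Q \<searrow> 0" "\<And>n x. (cmod (cinner (z n) x))\<^sup>2 \<le> qform (Q n) x"
    using orthonormal_tails[of z, OF z] by metis
  define E where "E n = id_blinfun - outer (z n) (z n)" for n
  have E: "E n \<in> pos_ops" for n using z by (simp add: E_def)
  define W V where "W = Y + outer r r" and "V = A + b *\<^sub>R outer r r"
  have W: "W \<in> pos_ops" and V: "V \<in> pos_ops" using Y A b by (simp_all add: W_def V_def)
  \<comment> \<open>The factor 1 + 1/\<eta> comes from the weighted estimate in \<open>cut\<close>;
    the sum of both norms lets one \<kappa> serve W and V.\<close>
  define \<kappa> where "\<kappa> = (1 + 1 / \<eta>) * (norm W + norm V)"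
  have \<kappa>: "0 \<le> \<kappa>" using \<eta> by (simp add: \<kappa>_def)
  have cut: "qform (E n o\<^sub>L U o\<^sub>L E n) y \<le> qform ((1 + \<eta>) *\<^sub>R U + \<kappa> *\<^sub>R Q n) y"
    if U: "U \<in> pos_ops" "norm U \<le> norm W + norm V" for U n y
  proof -
    define w where "w = cinner (z n) y *\<^sub>C z n"
    \<comment> \<open>With E n y = y - w, this bounds the cross term by \<eta> times the form at y
      plus 1/\<eta> times the form at w; the latter is controlled by Q n.\<close>
    have "qform U (sqrt \<eta> *\<^sub>R y + (1 / sqrt \<eta>) *\<^sub>R w) \<ge> 0" by (rule qform_nonneg[OF U(1)])
    hence pol: "0 \<le> \<eta> * qform U y + 2 * Re (cinner y (U w)) + (1 / \<eta>) * qform U w"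
      using \<eta> unfolding qform_add_vec[OF U(1)]
      by (simp add: qform_scaleR_vec[OF U(1)] blinfun.scaleR_right cinner_scaleR_left
          cinner_scaleR_right power_divide)
    have "E n y = y + (-1) *\<^sub>R w"
      by (simp add: E_def blinfun.diff_left outer_apply w_def)
    hence "qform U (E n y) = qform U y - 2 * Re (cinner y (U w)) + qform U w"
      unfolding qform_add_vec[OF U(1)] \<open>E n y = _\<close>
      by (simp only: qform_scaleR_vec[OF U(1)] blinfun.scaleR_right cinner_scaleR_right) simp
    also have "\<dots> \<le> (1 + \<eta>) * qform U y + (1 + 1 / \<eta>) * qform U w"
      using pol by (simp add: algebra_simps)
    also have "qform U w = (cmod (cinner (z n) y))\<^sup>2 * qform U (z n)"
      by (simp add: w_def qform_scaleC_vec[OF U(1)])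
    also have "(1 + 1 / \<eta>) * \<dots> \<le> (1 + 1 / \<eta>) * (qform (Q n) y * (norm W + norm V))"
      using qform_le_norm[of U "z n"] z U(2) \<eta> qform_nonneg[OF Q(1)] qform_nonneg[OF U(1)]
      by (intro mult_left_mono mult_mono Q(3)) auto
    finally show ?thesis
      by (simp add: qform_sandwich[OF E] qform_add qform_scaleR \<kappa>_def algebra_simps)
  qed
  have Q_lim: "(\<lambda>n. qform (Q n) y) \<longlonglongrightarrow> 0" for y
    using tendsto_qform[of Q y 0] Q(2) by (simp add: sot_decreasing_to_def)
  have "(\<lambda>n. (cmod (cinner (z n) y))\<^sup>2) \<longlonglongrightarrow> 0" for y
    by (rule tendsto_sandwich[OF _ _ tendsto_const Q_lim[of y]]) (auto simp: Q(3))
  hence "(\<lambda>n. sqrt ((cmod (cinner (z n) y))\<^sup>2)) \<longlonglongrightarrow> sqrt 0" for y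
    by (intro tendsto_real_sqrt)
  hence z_lim: "(\<lambda>n. cmod (cinner (z n) y)) \<longlonglongrightarrow> 0" for y by simp
  have E_lim: "(\<lambda>n. E n y) \<longlonglongrightarrow> y" for y
  proof -
    have "(\<lambda>n. cinner (z n) y *\<^sub>C z n) \<longlonglongrightarrow> 0"
      by (rule tendsto_norm_zero_cancel) (simp add: norm_scaleC z z_lim)
    from tendsto_diff[OF tendsto_const this, of y] show ?thesis
      by (simp add: E_def blinfun.diff_left outer_apply)
  qed
  define R where "R n = \<sigma> ((1 + \<eta>) *\<^sub>R W + \<kappa> *\<^sub>R Q n) ((1 + \<eta>) *\<^sub>R V + \<kappa> *\<^sub>R Q n)" for n
  have "R \<searrow> \<sigma> ((1 + \<eta>) *\<^sub>R W) ((1 + \<eta>) *\<^sub>R V)"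
    unfolding R_def using W V Q(1) \<eta> \<kappa> sot_decreasing_scale_add[OF Q(2) \<kappa>]
    by (intro mean_decreasing) auto
  hence R_lim: "(\<lambda>n. qform (R n) x) \<longlonglongrightarrow> qform (\<sigma> ((1 + \<eta>) *\<^sub>R W) ((1 + \<eta>) *\<^sub>R V)) x"
    by (intro tendsto_qform) (simp add: sot_decreasing_to_def)
  have "qform (\<sigma> Y A) (E n x) + repr b * (cmod (cinner (E n r) x))\<^sup>2 \<le> qform (R n) x" for n
  proof -
    have "qform (\<sigma> Y A) (E n x) + repr b * (cmod (cinner (E n r) x))\<^sup>2
        \<le> qform (\<sigma> (E n o\<^sub>L W o\<^sub>L E n) (E n o\<^sub>L V o\<^sub>L E n)) x"
      unfolding W_def V_def E_def by (rule mean_add_rank_one_compressed[OF Y A b z(1)])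
    also have "\<dots> \<le> qform (R n) x"
      unfolding R_def using W V E Q(1) \<eta> \<kappa> by (intro mean_mono cut) auto
    finally show ?thesis .
  qed
  moreover have "(\<lambda>n. qform (\<sigma> Y A) (E n x) + repr b * (cmod (cinner (E n r) x))\<^sup>2)
      \<longlonglongrightarrow> qform (\<sigma> Y A) x + repr b * (cmod (cinner r x))\<^sup>2"
    by (intro tendsto_add tendsto_mult tendsto_const tendsto_power tendsto_norm tendsto_cinner
        tendsto_qform_vec E_lim)
  ultimately show ?thesis
    unfolding W_def[symmetric] V_def[symmetric] using R_lim by (intro LIMSEQ_le) auto
qed

end

lemma pos_inv_ops_pos: "T \<in> pos_inv_ops \<Longrightarrow> T \<in> pos_ops"
  by (simp add: pos_inv_ops_def)

text \<open>Moving a small rank-one piece of Y, matched with b times it from A, through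
  \<open>mean_add_rank_one\<close> yields a gain \<gamma> Y. The bound Y \<sigma> A \<le> f(K) Y
  turns this additive gain into a factor below 1.\<close>

lemma (in kubo_ando_mean) mean_strict_mono_right:
  assumes nontriv: "\<not> means_equal \<sigma> left_trivial_mean"
    and "Y \<in> pos_inv_ops" "A \<in> pos_inv_ops" and s: "0 < s" "s < 1"
  obtains c where "0 < c" "c < 1" "\<And>x. qform (\<sigma> Y (s *\<^sub>R A)) x \<le> c * qform (\<sigma> Y A) x"
proof -
  have Y: "Y \<in> pos_ops" and A: "A \<in> pos_ops" using assms by (auto simp: pos_inv_ops_pos)
  obtain K where K: "K > 0" "\<And>x. qform A x \<le> K * qform Y x"
    using pos_inv_ops_dominates[OF \<open>Y \<in> pos_inv_ops\<close>] by metis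
  obtain L where L: "L > 0" "\<And>x. qform Y x \<le> L * qform A x"
    using pos_inv_ops_dominates[OF \<open>A \<in> pos_inv_ops\<close>] by metis
  obtain b where b: "b \<ge> K" "repr K < repr b"
    using repr_strict[OF nontriv, of K] K by auto
  have rK: "repr K \<ge> 0" using K by (intro repr_nonneg) simp
  \<comment> \<open>Half the gap between f(K) and f(b), normalised so that (1 + \<delta>) f(K) <
    f(b) also when f(K) = 0.\<close>
  define \<delta> where "\<delta> = (repr b - repr K) / 2 / (repr K + 1)"
  have \<delta>: "\<delta> > 0" using b rK by (simp add: \<delta>_def)
  have "\<delta> * (repr K + 1) = (repr b - repr K) / 2"
    by (rule nonzero_eq_divide_eq[THEN iffD1, OF _ \<delta>_def]) (use rK in simp)
  hence gain: "(1 + \<delta>) * repr K < repr b" using b \<delta> by (simp add: algebra_simps)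
  \<comment> \<open>The second condition gives \<mu> > 0; the third keeps the enlarged second
    argument below A in \<open>le2\<close>.\<close>
  obtain \<epsilon> where \<epsilon>: "\<epsilon> > 0" "(1 + \<delta>) * \<epsilon> < 1" "(1 + \<epsilon> * \<delta>) * (s + b * \<epsilon> * L) < 1"
  proof -
    have "((\<lambda>e. (1 + \<delta>) * e) \<longlongrightarrow> (1 + \<delta>) * 0) (at_right 0)"
      by (intro tendsto_intros)
    hence 1: "\<forall>\<^sub>F e in at_right 0. (1 + \<delta>) * e < 1" by (rule order_tendstoD) simp
    have "((\<lambda>e. (1 + e * \<delta>) * (s + b * e * L)) \<longlongrightarrow> (1 + 0 * \<delta>) * (s + b * 0 * L)) (at_right 0)"
      by (intro tendsto_intros)
    hence 2: "\<forall>\<^sub>F e in at_right 0. (1 + e * \<delta>) * (s + b * e * L) < 1"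
      by (rule order_tendstoD) (use s in simp)
    have "\<forall>\<^sub>F e in at_right (0::real). e > 0" by (rule eventually_at_right_less)
    from eventually_happens[OF eventually_conj[OF this eventually_conj[OF 1 2]]] that
    show ?thesis by (auto simp: trivial_limit_at_right_real)
  qed
  define \<eta> where "\<eta> = \<epsilon> * \<delta>"
  \<comment> \<open>Chosen so that (1 + \<eta>)(\<mu> + \<epsilon>) = 1 -
    \<open>\<eta>\<^sup>2\<close>, which is at most 1 as \<open>le1\<close> requires.\<close>
  define \<mu> where "\<mu> = 1 - \<epsilon> - \<eta>"
  have \<eta>: "\<eta> > 0" and \<mu>: "\<mu> > 0" "\<mu> < 1"
    using \<epsilon> \<delta> by (auto simp: \<eta>_def \<mu>_def algebra_simps add_pos_pos)
  \<comment> \<open>The gain \<epsilon> f(b) minus the loss (\<epsilon> + \<eta>) f(K), since \<eta>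
    = \<epsilon> \<delta>.\<close>
  define \<gamma> where "\<gamma> = \<epsilon> * (repr b - (1 + \<delta>) * repr K)"
  have \<gamma>: "\<gamma> > 0" using \<epsilon> gain by (simp add: \<gamma>_def)
  have below: "qform (\<sigma> Y (s *\<^sub>R A)) x + \<gamma> * qform Y x \<le> qform (\<sigma> Y A) x" for x
  proof -
    obtain r where r: "\<And>y. (cmod (cinner r y))\<^sup>2 \<le> qform Y y" "(cmod (cinner r x))\<^sup>2 = qform Y x"
      using rank_one_minorant[OF Y] by metis
    define t where "t = sqrt \<epsilon> *\<^sub>R r"
    have t: "(cmod (cinner t y))\<^sup>2 = \<epsilon> * (cmod (cinner r y))\<^sup>2" for y
      using \<epsilon> by (simp add: t_def cinner_scaleR_left norm_mult power_mult_distrib)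
    have t_le: "(cmod (cinner t y))\<^sup>2 \<le> \<epsilon> * qform Y y" for y
      unfolding t using \<epsilon> r(1) by (intro mult_left_mono) auto
    have le1: "qform ((1 + \<eta>) *\<^sub>R (\<mu> *\<^sub>R Y + outer t t)) y \<le> qform Y y" for y
    proof -
      have "(1 + \<eta>) * (\<mu> * qform Y y + (cmod (cinner t y))\<^sup>2) \<le> (1 + \<eta>) * (\<mu> * qform Y y + \<epsilon> * qform Y y)"
        using \<eta> \<mu> t_le by (intro mult_left_mono add_mono) auto
      also have "\<dots> = (1 - \<eta>\<^sup>2) * qform Y y"
        by (simp add: \<mu>_def power2_eq_square algebra_simps)
      also have "\<dots> \<le> 1 * qform Y y"
        by (intro mult_right_mono qform_nonneg Y) simp
      finally show ?thesis by (simp add: qform_scaleR qform_add qform_outer)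
    qed
    have le2: "qform ((1 + \<eta>) *\<^sub>R (s *\<^sub>R A + b *\<^sub>R outer t t)) y \<le> qform A y" for y
    proof -
      have "\<epsilon> * qform Y y \<le> \<epsilon> * (L * qform A y)" using L \<epsilon> by simp
      hence "(cmod (cinner t y))\<^sup>2 \<le> \<epsilon> * (L * qform A y)" using t_le[of y] by linarith
      hence "(1 + \<eta>) * (s * qform A y + b * (cmod (cinner t y))\<^sup>2)
          \<le> (1 + \<eta>) * (s * qform A y + b * (\<epsilon> * (L * qform A y)))"
        using \<eta> b K s by (intro mult_left_mono add_mono) auto
      also have "\<dots> = ((1 + \<epsilon> * \<delta>) * (s + b * \<epsilon> * L)) * qform A y"
        by (simp add: \<eta>_def algebra_simps)
      also have "\<dots> \<le> 1 * qform A y"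
        using \<epsilon> by (intro mult_right_mono qform_nonneg A) simp
      finally show ?thesis by (simp add: qform_scaleR qform_add qform_outer)
    qed
    have "\<mu> * qform (\<sigma> Y (s *\<^sub>R A)) x = qform (\<sigma> (\<mu> *\<^sub>R Y) (\<mu> *\<^sub>R s *\<^sub>R A)) x"
      using mean_scaleR[of Y "s *\<^sub>R A" \<mu>] Y A s \<mu> by (simp only: pos_ops_scaleR qform_scaleR less_imp_le)
    also have "\<dots> \<le> qform (\<sigma> (\<mu> *\<^sub>R Y) (s *\<^sub>R A)) x"
      using Y A s \<mu> qform_nonneg[OF A]
      by (intro mean_mono) (auto simp: qform_scaleR intro!: mult_left_le_one_le)
    finally have "\<mu> * qform (\<sigma> Y (s *\<^sub>R A)) x + repr b * (\<epsilon> * qform Y x)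
        \<le> qform (\<sigma> (\<mu> *\<^sub>R Y) (s *\<^sub>R A)) x + repr b * (cmod (cinner t x))\<^sup>2"
      by (simp add: t r)
    also have "\<dots> \<le> qform (\<sigma> ((1 + \<eta>) *\<^sub>R (\<mu> *\<^sub>R Y + outer t t)) ((1 + \<eta>) *\<^sub>R (s *\<^sub>R A + b *\<^sub>R outer t t))) x"
      using Y A s \<mu> \<eta> b K by (intro mean_add_rank_one) auto
    also have "\<dots> \<le> qform (\<sigma> Y A) x"
      using Y A s \<mu> \<eta> b K by (intro mean_mono le1 le2) auto
    finally have 1: "\<mu> * qform (\<sigma> Y (s *\<^sub>R A)) x + repr b * (\<epsilon> * qform Y x) \<le> qform (\<sigma> Y A) x" .
    \<comment> \<open>Scaling Y by \<mu> gave up the share 1 - \<mu> = \<epsilon> + \<eta> of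
      \<open>\<sigma> Y (s *\<^sub>R A)\<close>; this bounds that share, using sA \<le> A \<le>
      KY.\<close>
    have "qform (\<sigma> Y (s *\<^sub>R A)) x \<le> qform (\<sigma> Y (K *\<^sub>R Y)) x"
    proof (rule mean_mono)
      show "qform (s *\<^sub>R A) y \<le> qform (K *\<^sub>R Y) y" for y
        using K(2)[of y] mult_left_le_one_le[OF qform_nonneg[OF A, of y], of s] s
        by (simp add: qform_scaleR)
    qed (use Y A s K in auto)
    also have "\<dots> \<le> repr K * qform Y x" using K Y by (intro mean_multiple_le) auto
    finally have "(\<epsilon> + \<eta>) * qform (\<sigma> Y (s *\<^sub>R A)) x \<le> (\<epsilon> + \<eta>) * (repr K * qform Y x)"
      using \<epsilon> \<eta> by (intro mult_left_mono) auto
    thus ?thesis using 1 by (simp add: \<mu>_def \<gamma>_def \<eta>_def algebra_simps)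
  qed
  \<comment> \<open>N exceeds f(K), so that Y \<sigma> A \<le> N Y, and exceeds \<gamma>, so that 1
    - \<gamma>/N lies strictly between 0 and 1.\<close>
  define N where "N = repr K + \<gamma> + 1"
  have N: "N > \<gamma>" "N > 0" using \<gamma> rK by (auto simp: N_def)
  have "qform (\<sigma> Y (s *\<^sub>R A)) x \<le> (1 - \<gamma> / N) * qform (\<sigma> Y A) x" for x
  proof -
    have "qform (\<sigma> Y A) x \<le> qform (\<sigma> Y (K *\<^sub>R Y)) x"
      using Y A K by (intro mean_mono) (auto simp: qform_scaleR)
    also have "\<dots> \<le> repr K * qform Y x" using K Y by (intro mean_multiple_le) auto
    also have "\<dots> \<le> N * qform Y x"
      using \<gamma> by (intro mult_right_mono qform_nonneg Y) (auto simp: N_def)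
    finally have "\<gamma> / N * qform (\<sigma> Y A) x \<le> \<gamma> / N * (N * qform Y x)"
      using \<gamma> N by (intro mult_left_mono) auto
    also have "\<dots> = \<gamma> * qform Y x" using N by simp
    finally show ?thesis using below[of x] by (simp add: algebra_simps)
  qed
  moreover have "0 < 1 - \<gamma> / N" "1 - \<gamma> / N < 1" using \<gamma> N by auto
  ultimately show ?thesis using that by blast
qed

section \<open>The fixed point\<close>

lemma fixed_point_le:
  fixes \<tau> \<sigma> :: "'a::complex_hilbert_space operator \<Rightarrow> 'a operator \<Rightarrow> 'a operator"
  assumes "kubo_ando_mean \<tau>" "kubo_ando_mean \<sigma>" and nontriv: "\<not> means_equal \<sigma> left_trivial_mean"
    and A: "A \<in> pos_inv_ops" and B: "B \<in> pos_inv_ops"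
    and X: "X \<in> pos_inv_ops" "X = \<tau> (\<sigma> X A) (\<sigma> X B)"
    and Y: "Y \<in> pos_inv_ops" "Y = \<tau> (\<sigma> Y A) (\<sigma> Y B)"
  shows "qform X x \<le> qform Y x"
proof -
  interpret t: kubo_ando_mean \<tau> by fact
  interpret s: kubo_ando_mean \<sigma> by fact
  have pos: "A \<in> pos_ops" "B \<in> pos_ops" "X \<in> pos_ops" "Y \<in> pos_ops"
    using A B X Y by (auto simp: pos_inv_ops_pos)
  \<comment> \<open>The condition 1 \<le> l bounds S below and suffices, the goal being l = 1; S is
    closed, so its infimum is attained.\<close>
  define S where "S = {l. 1 \<le> l \<and> (\<forall>x. qform X x \<le> l * qform Y x)}"
  obtain l0 where l0: "l0 > 0" "\<And>x. qform X x \<le> l0 * qform Y x"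
    using pos_inv_ops_dominates[OF Y(1)] by metis
  have "qform X x \<le> max 1 l0 * qform Y x" for x
    using l0(2)[of x] mult_right_mono[of l0 "max 1 l0" "qform Y x"] qform_nonneg[OF pos(4), of x] by simp
  hence "S \<noteq> {}" by (auto simp: S_def intro!: exI[of _ "max 1 l0"])
  have bdd: "bdd_below S" by (auto simp: S_def intro!: bdd_belowI[of _ 1])
  have "closed S" unfolding S_def
    by (intro closed_Collect_conj closed_Collect_all closed_Collect_le continuous_intros)
  define l where "l = Inf S"
  have "l \<in> S" unfolding l_def by (rule closed_contains_Inf) fact+
  hence l: "1 \<le> l" "\<And>x. qform X x \<le> l * qform Y x" by (auto simp: S_def)
  have "l = 1"
  proof (rule ccontr)
    assume "l \<noteq> 1"
    hence "l > 1" using l by simp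
    obtain c1 where c1: "0 < c1" "c1 < 1" "\<And>x. qform (\<sigma> Y ((1 / l) *\<^sub>R A)) x \<le> c1 * qform (\<sigma> Y A) x"
      using s.mean_strict_mono_right[OF nontriv Y(1) A, of "1 / l"] \<open>l > 1\<close> by auto
    obtain c2 where c2: "0 < c2" "c2 < 1" "\<And>x. qform (\<sigma> Y ((1 / l) *\<^sub>R B)) x \<le> c2 * qform (\<sigma> Y B) x"
      using s.mean_strict_mono_right[OF nontriv Y(1) B, of "1 / l"] \<open>l > 1\<close> by auto
    \<comment> \<open>A common factor for A and B, so that homogeneity of \<tau> can pull it
      out.\<close>
    define c where "c = max c1 c2"
    have c: "0 < c" "c < 1" "c1 \<le> c" "c2 \<le> c" using c1 c2 by (auto simp: c_def)
    have shrink: "qform (\<sigma> X D) x \<le> l * c * qform (\<sigma> Y D) x"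
      if D: "D \<in> pos_ops" and d: "d \<le> c" "\<And>x. qform (\<sigma> Y ((1 / l) *\<^sub>R D)) x \<le> d * qform (\<sigma> Y D) x"
      for D d x
    proof -
      have "qform (\<sigma> X D) x \<le> qform (\<sigma> (l *\<^sub>R Y) D) x"
        using l pos D by (intro s.mean_mono) (auto simp: qform_scaleR)
      also have "\<sigma> (l *\<^sub>R Y) D = l *\<^sub>R \<sigma> Y ((1 / l) *\<^sub>R D)"
        using s.mean_scaleR[of Y "(1 / l) *\<^sub>R D" l] pos D \<open>l > 1\<close> by simp
      also have "qform \<dots> x \<le> l * (c * qform (\<sigma> Y D) x)"
        unfolding qform_scaleR
      proof (rule mult_left_mono)
        have "d * qform (\<sigma> Y D) x \<le> c * qform (\<sigma> Y D) x"
          using d pos D by (intro mult_right_mono qform_nonneg) auto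
        thus "qform (\<sigma> Y ((1 / l) *\<^sub>R D)) x \<le> c * qform (\<sigma> Y D) x" using d(2)[of x] by linarith
      qed (use l in simp)
      finally show ?thesis by simp
    qed
    have "qform X x \<le> l * c * qform Y x" for x
    proof -
      have "qform X x = qform (\<tau> (\<sigma> X A) (\<sigma> X B)) x" using X(2) by simp
      also have "\<dots> \<le> qform (\<tau> ((l * c) *\<^sub>R \<sigma> Y A) ((l * c) *\<^sub>R \<sigma> Y B)) x"
        using pos l c shrink[OF pos(1) c(3) c1(3)] shrink[OF pos(2) c(4) c2(3)]
        by (intro t.mean_mono) (auto simp: qform_scaleR)
      also have "\<tau> ((l * c) *\<^sub>R \<sigma> Y A) ((l * c) *\<^sub>R \<sigma> Y B) = (l * c) *\<^sub>R Y"
        using t.mean_scaleR[of "\<sigma> Y A" "\<sigma> Y B" "l * c"] pos l c Y(2) by simp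
      finally show ?thesis by (simp add: qform_scaleR)
    qed
    \<comment> \<open>The product l c may drop below 1 and leave S; the maximum with 1 stays in S
      and is still smaller than l.\<close>
    moreover have "l * c * qform Y x \<le> max 1 (l * c) * qform Y x" for x
      by (intro mult_right_mono qform_nonneg pos) simp
    ultimately have "max 1 (l * c) \<in> S" unfolding S_def by (auto intro: order.trans)
    hence "l \<le> max 1 (l * c)" unfolding l_def by (rule cInf_lower[OF _ bdd])
    thus False using \<open>l > 1\<close> c by (simp add: max_def split: if_splits)
  qed
  thus ?thesis using l(2)[of x] by simp
qed

lemma fixed_point_exists:
  fixes \<tau> \<sigma> :: "'a::complex_hilbert_space operator \<Rightarrow> 'a operator \<Rightarrow> 'a operator"
  assumes "kubo_ando_mean \<tau>" "kubo_ando_mean \<sigma>"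
    and A: "A \<in> pos_inv_ops" and B: "B \<in> pos_inv_ops"
  obtains X where "X \<in> pos_inv_ops" "X = \<tau> (\<sigma> X A) (\<sigma> X B)"
proof -
  interpret t: kubo_ando_mean \<tau> by fact
  interpret s: kubo_ando_mean \<sigma> by fact
  have pos: "A \<in> pos_ops" "B \<in> pos_ops" using A B by (auto simp: pos_inv_ops_pos)
  obtain k1 where k1: "k1 > 0" "\<And>x. k1 * (norm x)\<^sup>2 \<le> qform A x" using pos_inv_ops_bounded_below[OF A] by metis
  obtain k2 where k2: "k2 > 0" "\<And>x. k2 * (norm x)\<^sup>2 \<le> qform B x" using pos_inv_ops_bounded_below[OF B] by metis
  define k where "k = min k1 k2"
  have k_le: "k * (norm x)\<^sup>2 \<le> k1 * (norm x)\<^sup>2" "k * (norm x)\<^sup>2 \<le> k2 * (norm x)\<^sup>2" for x :: 'a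
    by (auto simp: k_def intro!: mult_right_mono)
  have k: "k > 0" "k * (norm x)\<^sup>2 \<le> qform A x" "k * (norm x)\<^sup>2 \<le> qform B x" for x
    using k1(1) k2(1) order.trans[OF k_le(1) k1(2)] order.trans[OF k_le(2) k2(2)] by (simp_all add: k_def)
  define m where "m = norm A + norm B + k"
  have m: "m > 0" "k \<le> m" using k by (auto simp: m_def add_nonneg_pos)
  have "norm A * (norm x)\<^sup>2 \<le> m * (norm x)\<^sup>2" "norm B * (norm x)\<^sup>2 \<le> m * (norm x)\<^sup>2" for x :: 'a
    using k by (auto simp: m_def intro!: mult_right_mono)
  hence m_ge: "qform A x \<le> m * (norm x)\<^sup>2" "qform B x \<le> m * (norm x)\<^sup>2" for x
    using qform_le_norm[of A x] qform_le_norm[of B x] by (auto intro: order.trans)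
  define F where "F X = \<tau> (\<sigma> X A) (\<sigma> X B)" for X
  have F_pos: "F X \<in> pos_ops" if "X \<in> pos_ops" for X using that pos by (simp add: F_def)
  have F_mono: "qform (F X) x \<le> qform (F Y) x"
    if "X \<in> pos_ops" "Y \<in> pos_ops" "\<And>x. qform X x \<le> qform Y x" for X Y x
    unfolding F_def using that pos by (intro t.mean_mono s.mean_mono) auto
  \<comment> \<open>Replacing A and B by cI turns cI into a fixed point; comparison with c = m and c
    = k makes the interval from kI to mI invariant under F.\<close>
  have scalar: "\<tau> (\<sigma> (c *\<^sub>R id_blinfun) (c *\<^sub>R id_blinfun)) (\<sigma> (c *\<^sub>R id_blinfun) (c *\<^sub>R id_blinfun))
      = c *\<^sub>R id_blinfun" if "c > 0" for c
    using that by (simp add: s.mean_scaleR t.mean_scaleR s.mean_id t.mean_id)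
  have F_m: "qform (F (m *\<^sub>R id_blinfun)) x \<le> m * (norm x)\<^sup>2" for x
  proof -
    have "qform (F (m *\<^sub>R id_blinfun)) x
      \<le> qform (\<tau> (\<sigma> (m *\<^sub>R id_blinfun) (m *\<^sub>R id_blinfun)) (\<sigma> (m *\<^sub>R id_blinfun) (m *\<^sub>R id_blinfun))) x"
      unfolding F_def using pos m m_ge by (intro t.mean_mono s.mean_mono) (auto simp: qform_scaleR)
    thus ?thesis by (simp add: scalar[OF m(1)] qform_scaleR)
  qed
  have F_k: "k * (norm x)\<^sup>2 \<le> qform (F (k *\<^sub>R id_blinfun)) x" for x
  proof -
    have "qform (\<tau> (\<sigma> (k *\<^sub>R id_blinfun) (k *\<^sub>R id_blinfun)) (\<sigma> (k *\<^sub>R id_blinfun) (k *\<^sub>R id_blinfun))) x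
      \<le> qform (F (k *\<^sub>R id_blinfun)) x"
      unfolding F_def using pos k by (intro t.mean_mono s.mean_mono) (auto simp: qform_scaleR)
    thus ?thesis by (simp add: scalar[OF k(1)] qform_scaleR)
  qed
  define X where "X n = (F ^^ n) (m *\<^sub>R id_blinfun)" for n
  have X_Suc: "X (Suc n) = F (X n)" and X_0: "X 0 = m *\<^sub>R id_blinfun" for n by (simp_all add: X_def)
  have X_pos: "X n \<in> pos_ops" for n
    by (induction n) (use m in \<open>auto simp: X_Suc X_0 F_pos\<close>)
  have X_ge: "k * (norm x)\<^sup>2 \<le> qform (X n) x" for n x
  proof (induction n arbitrary: x)
    case 0
    thus ?case using m by (simp add: X_0 qform_scaleR mult_right_mono)
  next
    case (Suc n)
    have "qform (F (k *\<^sub>R id_blinfun)) x \<le> qform (F (X n)) x"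
      using Suc k X_pos by (intro F_mono) (auto simp: qform_scaleR)
    thus ?case using F_k[of x] by (simp add: X_Suc)
  qed
  have "qform (X (Suc n)) x \<le> qform (X n) x" for n x
  proof (induction n arbitrary: x)
    case 0
    thus ?case using F_m by (simp add: X_Suc X_0 qform_scaleR)
  next
    case (Suc n)
    thus ?case unfolding X_Suc[of "Suc n"] X_Suc[of n] using X_pos F_pos
      by (intro F_mono) (auto simp: X_Suc)
  qed
  hence X_dec: "X (Suc n) \<preceq> X n" for n using X_pos by (simp add: op_le_iff)
  obtain L where L: "L \<in> pos_ops" "X \<searrow> L"
    using Vigier[of X, OF X_pos X_dec] by metis
  \<comment> \<open>Axiom (III) for \<sigma>, with A and B as constant sequences, produces
    decreasing sequences to which axiom (III) for \<tau> applies.\<close>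
  have "(\<lambda>n. F (X n)) \<searrow> F L"
    unfolding F_def using pos X_pos L sot_decreasing_const
    by (intro t.mean_decreasing s.mean_decreasing) auto
  hence FL: "(\<lambda>n. X (Suc n) x) \<longlonglongrightarrow> F L x" for x
    by (simp add: X_Suc sot_decreasing_to_def)
  have XL: "(\<lambda>n. X n x) \<longlonglongrightarrow> L x" for x using L by (simp add: sot_decreasing_to_def)
  have "L = F L"
    by (intro blinfun_eqI LIMSEQ_unique[OF LIMSEQ_Suc[OF XL] FL])
  \<comment> \<open>The uniform lower bound of the iterates survives the limit and makes L
    invertible.\<close>
  moreover have "k * (norm x)\<^sup>2 \<le> qform L x" for x
    by (rule LIMSEQ_le_const[OF tendsto_qform[OF XL]]) (use X_ge in blast)
  hence "L \<in> pos_inv_ops" by (rule bounded_below_pos_inv_ops[OF L(1) k(1)])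
  ultimately show ?thesis using that by (simp add: F_def)
qed

theorem lemma2p6:
  fixes \<tau> \<sigma> :: "'a::complex_hilbert_space operator \<Rightarrow> 'a operator \<Rightarrow> 'a operator"
    and A B :: "'a operator"
  assumes "infinite_dimensional TYPE('a)"
    and "separable_space (euclidean :: 'a topology)"
    and "operator_mean \<tau>"
    and "operator_mean \<sigma>"
    and "\<not> means_equal \<sigma> left_trivial_mean"
    and "A \<in> pos_inv_ops"
    and "B \<in> pos_inv_ops"
  shows "\<exists>!X\<^sub>0. X\<^sub>0 \<in> pos_inv_ops \<and> X\<^sub>0 = \<tau> (\<sigma> X\<^sub>0 A) (\<sigma> X\<^sub>0 B)"
proof -
  have means: "kubo_ando_mean \<tau>" "kubo_ando_mean \<sigma>"
    using assms by (simp_all add: kubo_ando_mean_def)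
  obtain X where X: "X \<in> pos_inv_ops \<and> X = \<tau> (\<sigma> X A) (\<sigma> X B)"
    using fixed_point_exists[OF means assms(6,7)] by metis
  show ?thesis
  proof (rule ex1I[of _ X])
    fix Y assume Y: "Y \<in> pos_inv_ops \<and> Y = \<tau> (\<sigma> Y A) (\<sigma> Y B)"
    have "qform X x \<le> qform Y x" "qform Y x \<le> qform X x" for x
      using X Y by (auto intro: fixed_point_le[OF means assms(5-7)])
    thus "Y = X"
      using X Y by (intro op_le_antisym) (auto simp: op_le_iff pos_inv_ops_pos)
  qed (rule X)
qed

end
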